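(* Let $m,n\ge1$, $\ell>0$, let $h_{\mathrm{simp}}:\mathbb{R}^{m\times n}\to[0,\infty)$ be $h_{\mathrm{simp}}(\xi):=\min\{|\xi|^2,\ell|\xi|\}$, and let $h_{\mathrm{simp}}^{\mathrm{conv}}$ and $h_{\mathrm{simp}}^{\mathrm{qc}}$ be its convex and quasiconvex envelopes. Let $\xi\in\mathbb{R}^{m\times n}$. (i) If $|\xi|\le\frac\ell2$, then $h_{\mathrm{simp}}(\xi)=h_{\mathrm{simp}}^{\mathrm{qc}}(\xi)=h_{\mathrm{simp}}^{\mathrm{conv}}(\xi)$. (ii) If $\operatorname{rank}\xi\le1$, then $h_{\mathrm{simp}}^{\mathrm{qc}}(\xi)=h_{\mathrm{simp}}^{\mathrm{conv}}(\xi)$. (iii) If $\operatorname{rank}\xi\ge2$ and $|\xi|>\frac\ell2$, then $h_{\mathrm{simp}}^{\mathrm{conv}}(\xi)<h_{\mathrm{simp}}^{\mathrm{qc}}(\xi)$.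
   Context: $|\cdot|$ is the Euclidean (Frobenius) norm on $\mathbb{R}^{m\times n}$, $|\xi|^2=\sum_{ij}\xi_{ij}^2$. The quasiconvex envelope is $h^{\mathrm{qc}}(\xi):=\inf\{\int_{(0,1)^n}h(\xi+\nabla\varphi)\,dx:\varphi\in C_c^\infty((0,1)^n;\mathbb{R}^m)\}$; the convex envelope is the largest convex function not exceeding $h$. *)

theory Defs
  imports "HOL-Analysis.Analysis"
begin

lemma norm_matrix_eq_frobenius:
  fixes \<xi> :: "real^'n^'m"
  shows "(norm \<xi>)\<^sup>2 = (\<Sum>i\<in>UNIV. \<Sum>j\<in>UNIV. (\<xi> $ i $ j)\<^sup>2)"
  by (simp add: norm_vec_def L2_set_def sum_nonneg)

(* The derivative being total, "all partial derivatives are again C^k" is the usual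
   characterisation of C^(k+1) maps. *)
primrec C_order :: "nat \<Rightarrow> (real^'n \<Rightarrow> 'b::real_normed_vector) \<Rightarrow> bool" where
  "C_order 0 f \<longleftrightarrow> continuous_on UNIV f"
| "C_order (Suc k) f \<longleftrightarrow> (\<forall>x. f differentiable (at x)) \<and>
     (\<forall>j. C_order k (\<lambda>x. frechet_derivative f (at x) (axis j 1)))"

definition smooth :: "(real^'n \<Rightarrow> 'b::real_normed_vector) \<Rightarrow> bool" where
  "smooth f \<longleftrightarrow> (\<forall>k. C_order k f)"

definition unit_cube :: "(real^'n) set" where
  "unit_cube = {x. \<forall>j. 0 < x $ j \<and> x $ j < 1}"

(* Functions in the space C_c^infinity(U; R^m), U open, are represented by their extension
   by zero to the whole space, which is again smooth. *)
definition test_functions :: "(real^'n) set \<Rightarrow> (real^'n \<Rightarrow> real^'m) set" where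
  "test_functions U =
     {\<phi>. smooth \<phi> \<and> compact (closure {x. \<phi> x \<noteq> 0}) \<and> closure {x. \<phi> x \<noteq> 0} \<subseteq> U}"

(* Real-valued, so meaningful when the set of energies is bounded below and the integrands
   are integrable, e.g. for continuous h bounded below. *)
definition quasiconvex_envelope :: "(real^'n^'m \<Rightarrow> real) \<Rightarrow> real^'n^'m \<Rightarrow> real" where
  "quasiconvex_envelope h \<xi> =
     (INF \<phi> \<in> test_functions unit_cube. LINT x:unit_cube|lborel. h (\<xi> + jacobian \<phi> (at x)))"

(* Greatest element in the pointwise order; see convex_envelope_greatest for existence. *)
definition convex_envelope :: "('a::real_vector \<Rightarrow> real) \<Rightarrow> 'a \<Rightarrow> real" where
  "convex_envelope h = (GREATEST g. convex_on UNIV g \<and> g \<le> h)"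

definition h_simp :: "real \<Rightarrow> real^'n^'m \<Rightarrow> real" where
  "h_simp l \<xi> = min ((norm \<xi>)\<^sup>2) (l * norm \<xi>)"

lemma convex_envelope_greatest:
  fixes h :: "'a::real_vector \<Rightarrow> real"
  assumes g0: "convex_on UNIV g0" "g0 \<le> h"
  shows "convex_on UNIV (convex_envelope h)" "convex_envelope h \<le> h"
    and "\<And>g. convex_on UNIV g \<Longrightarrow> g \<le> h \<Longrightarrow> g \<le> convex_envelope h"
proof -
  define G where "G = {g. convex_on UNIV g \<and> g \<le> h}"
  define s where "s x = (SUP g\<in>G. g x)" for x
  have ne: "G \<noteq> {}" using g0 by (auto simp: G_def)
  have bd: "bdd_above ((\<lambda>g. g x) ` G)" for x
    by (rule bdd_aboveI[of _ "h x"]) (auto simp: G_def le_fun_def)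
  have up: "g x \<le> s x" if "g \<in> G" for g x
    unfolding s_def by (rule cSUP_upper[OF that bd])
  have sh: "s \<le> h"
    unfolding s_def
    by (rule le_funI, rule cSUP_least[OF ne]) (auto simp: G_def le_fun_def)
  have cs: "convex_on UNIV s"
  proof (rule convex_onI)
    fix t :: real and x y :: 'a
    assume t: "0 < t" "t < 1"
    show "s ((1 - t) *\<^sub>R x + t *\<^sub>R y) \<le> (1 - t) * s x + t * s y"
      unfolding s_def[of "(1 - t) *\<^sub>R x + t *\<^sub>R y"]
    proof (rule cSUP_least[OF ne])
      fix g assume g: "g \<in> G"
      then have "g ((1 - t) *\<^sub>R x + t *\<^sub>R y) \<le> (1 - t) * g x + t * g y"
        using t by (intro convex_onD[where A = UNIV]) (auto simp: G_def)
      also have "\<dots> \<le> (1 - t) * s x + t * s y"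
        using t by (intro add_mono mult_left_mono up g) auto
      finally show "g ((1 - t) *\<^sub>R x + t *\<^sub>R y) \<le> (1 - t) * s x + t * s y" .
    qed
  qed simp
  have eq: "convex_envelope h = s"
    unfolding convex_envelope_def
    by (rule Greatest_equality) (use cs sh up in \<open>auto simp: G_def le_fun_def\<close>)
  show "convex_on UNIV (convex_envelope h)" "convex_envelope h \<le> h"
    using cs sh by (auto simp: eq)
  show "g \<le> convex_envelope h" if "convex_on UNIV g" "g \<le> h" for g
    using that up by (auto simp: eq G_def le_fun_def)
qed

end

(* The convex envelope of h_simp is the Huber function W, and testing with the supporting affine
   functions of W gives W <= h_simp^qc; moreover W = h_simp on the ball of radius l/2.

   If xi is a multiple of a unit matrix X = a (x) e and |xi| = l/2 + c, the test functions are
   laminates a eta(x) P(kappa e.x) / kappa, where eta is a cutoff and P is bounded with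
   P' = c (sigma_r - 1), sigma_r being the Poisson kernel.  As r -> 1 the matrix
   xi + grad phi is close to (l/2) X up to rare, large positive multiples of X, on which h_simp
   grows with slope l.

   If rank xi >= 2 and |xi| > l/2, write grad phi = t X + P with X = xi / |xi| and P orthogonal
   to X, and s = c + t with c = |xi| - l/2.  A small energy excess forces P to be small in L^1 and s
   to be nonnegative with mean c but concentrated on a set E of small measure.  Two independent
   columns of X give scalar functions y, y' of phi with D_{d1} y and D_{d2} y' small and
   D_{d2} y, D_{d1} y' close to t = s - c, where d1, d2 = e_{j1} + e_{j2}, e_{j1} - e_{j2}.
   As in the Alberti-Csornyei-Preiss covering argument, the small set E splits, on a fine lattice,
   into two parts carrying only short chains in direction d1 resp. d2; the heights rho, rho' of
   longest chains are small potentials with bounded differences and increment 1 on their part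
   of E.  Summation by parts moves the derivatives of y off d2 onto d1, so that
   sum (s - c) (D_{d1} rho + D_{d2} rho') is small; but the left-hand side is at least
   sum_E s - c sum (D_{d1} rho + D_{d2} rho'), which is about c times the number of lattice points. *)

theory Submission
  imports Defs
begin

subsection \<open>Splitting a lattice set into two parts with short chains\<close>

text \<open>For rank at least two the obstacle is that only L^1 control is available: along a
  sequence of test functions with vanishing excess, \<open>s\<close> may concentrate, and the
  gradients converge only as measures. In the limit the singular part would be a multiple of
  \<open>X\<close>, which Alberti's rank-one theorem excludes. The lattice argument is a finite,
  quantitative substitute for that theorem. No compactness is used, because the gap must be uniform
  over all test functions. The lattice spacing \<open>1 / M\<close> depends on the test function,
  but the lattice estimate is proportional to the number \<open>M^2\<close> of points, so after
  dividing by \<open>M^2\<close> the constant depends only on \<open>c\<close> and \<open>X\<close>.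
  Diagonal directions are used because chains are ordered coordinatewise: a step along a diagonal
  moves both coordinates strictly, so it changes a chain height by at most one. For rank one,
  concentration is cheap because the excess of \<open>h_simp\<close> over its supporting affine
  function stays bounded along the ray; it therefore tends to zero in mean as soon as it tends to
  zero almost everywhere.\<close>

definition sw :: "int \<times> int \<Rightarrow> int \<times> int \<Rightarrow> bool" where
  "sw a b \<longleftrightarrow> fst a < fst b \<and> snd a < snd b"

definition nw :: "int \<times> int \<Rightarrow> int \<times> int \<Rightarrow> bool" where
  "nw a b \<longleftrightarrow> fst a < fst b \<and> snd a > snd b"

text \<open>Remove sw-chains with \<open>k + 1\<close> elements as long as there are any; an nw-chain meets each of them at most once.\<close>

lemma split_sw_nw:
  assumes "finite E" "card E \<le> m * (k + 1)"
  shows "\<exists>E'\<subseteq>E. (\<forall>C\<subseteq>E - E'. totalp_on C sw \<longrightarrow> card C \<le> k) \<and>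
                   (\<forall>C\<subseteq>E'. totalp_on C nw \<longrightarrow> card C \<le> m)"
  using assms
proof (induction m arbitrary: E)
  case 0
  then show ?case by (intro exI[of _ "{}"]) auto
next
  case (Suc m)
  show ?case
  proof (cases "\<forall>C\<subseteq>E. totalp_on C sw \<longrightarrow> card C \<le> k")
    case True
    then show ?thesis by (intro exI[of _ "{}"]) auto
  next
    case False
    then obtain C0 where C0: "C0 \<subseteq> E" "totalp_on C0 sw" "\<not> card C0 \<le> k" by blast
    then have "k + 1 \<le> card C0" by simp
    then obtain C where C: "C \<subseteq> C0" "card C = k + 1" "finite C"
      by (meson obtain_subset_with_card_n)
    have tot: "totalp_on C sw" using C C0 totalp_on_subset by blast
    have "card (E - C) \<le> m * (k + 1)"
      using Suc.prems C C0 by (subst card_Diff_subset) auto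
    then obtain E' where E': "E' \<subseteq> E - C"
      "\<And>D. D \<subseteq> E - C - E' \<Longrightarrow> totalp_on D sw \<Longrightarrow> card D \<le> k"
      "\<And>D. D \<subseteq> E' \<Longrightarrow> totalp_on D nw \<Longrightarrow> card D \<le> m"
      using Suc.IH[of "E - C"] Suc.prems by (metis finite_Diff)
    have "card D \<le> Suc m" if D: "D \<subseteq> E' \<union> C" "totalp_on D nw" for D
    proof -
      have "card (D \<inter> E') \<le> m" using E'(3)[of "D \<inter> E'"] D totalp_on_subset by blast
      moreover have "a = b" if "a \<in> D \<inter> C" "b \<in> D \<inter> C" for a b
      proof (rule ccontr)
        assume "a \<noteq> b"
        then have "sw a b \<or> sw b a" "nw a b \<or> nw b a"
          using that tot D by (auto simp: totalp_on_def)
        then show False by (auto simp: sw_def nw_def)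
      qed
      then have "card (D \<inter> C) \<le> 1"
        using C(3) by (subst card_le_Suc0_iff_eq[unfolded One_nat_def[symmetric]]) auto
      moreover have "card D \<le> card (D \<inter> E') + card (D \<inter> C)"
        using D(1) by (metis Int_Un_distrib card_Un_le inf.absorb_iff1)
      ultimately show ?thesis by linarith
    qed
    moreover have "E - (E' \<union> C) = E - C - E'" by blast
    ultimately show ?thesis
      using E' C C0 by (intro exI[of _ "E' \<union> C"]) auto
  qed
qed

section \<open>Heights of longest chains and the potentials they define\<close>

definition sw_height :: "(int \<times> int) set \<Rightarrow> int \<times> int \<Rightarrow> nat" where
  "sw_height X a = Max (card ` {C. C \<subseteq> X \<and> totalp_on C sw \<and> (\<forall>b\<in>C. fst b \<le> fst a \<and> snd b \<le> snd a)})"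

lemma sw_height_ge:
  assumes "finite X" "C \<subseteq> X" "totalp_on C sw" "\<And>b. b \<in> C \<Longrightarrow> fst b \<le> fst a \<and> snd b \<le> snd a"
  shows "card C \<le> sw_height X a"
  unfolding sw_height_def
  by (rule Max_ge) (use assms in \<open>auto intro!: finite_imageI finite_subset[of _ "Pow X"]\<close>)

lemma sw_height_obtain:
  assumes "finite X"
  obtains C where "C \<subseteq> X" "totalp_on C sw" "\<And>b. b \<in> C \<Longrightarrow> fst b \<le> fst a \<and> snd b \<le> snd a"
    "card C = sw_height X a"
proof -
  let ?S = "{C. C \<subseteq> X \<and> totalp_on C sw \<and> (\<forall>b\<in>C. fst b \<le> fst a \<and> snd b \<le> snd a)}"
  have "finite ?S" using assms by (auto intro!: finite_subset[of _ "Pow X"])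
  moreover have "?S \<noteq> {}" by (auto intro: exI[of _ "{}"])
  ultimately have "sw_height X a \<in> card ` ?S"
    unfolding sw_height_def by (intro Max_in) simp_all
  then obtain C where "C \<in> ?S" "card C = sw_height X a" by force
  then show ?thesis by (intro that[of C]) blast+
qed

lemma sw_height_mono:
  assumes "finite X" "fst a \<le> fst b" "snd a \<le> snd b"
  shows "sw_height X a \<le> sw_height X b"
proof -
  obtain C where "C \<subseteq> X" "totalp_on C sw" "\<And>b. b \<in> C \<Longrightarrow> fst b \<le> fst a \<and> snd b \<le> snd a"
    "card C = sw_height X a"
    using sw_height_obtain[OF assms(1)] by blast
  then show ?thesis using sw_height_ge[OF assms(1), of C b] assms by fastforce
qed

text \<open>Only the topmost element of a chain in the quadrant at \<open>a\<close> can leave the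
  quadrant at \<open>a - (1, 1)\<close>: all others lie strictly below it in both coordinates, and
  for integers strictly below means below by at least one.\<close>

lemma sw_height_step:
  assumes X: "finite X"
  shows "sw_height X a \<le> sw_height X (a - (1, 1)) + 1"
proof -
  obtain C where C: "C \<subseteq> X" "totalp_on C sw" "\<And>b. b \<in> C \<Longrightarrow> fst b \<le> fst a \<and> snd b \<le> snd a"
    "card C = sw_height X a"
    using sw_height_obtain[OF assms(1)] by blast
  have fC: "finite C" using C X finite_subset by blast
  show ?thesis
  proof (cases "C = {}")
    case True
    then show ?thesis using C by simp
  next
    case False
    \<comment> \<open>In a chain the first coordinates are pairwise distinct, so the largest one
      singles out the topmost element.\<close>
    have "Max (fst ` C) \<in> fst ` C" using fC False by (intro Max_in) auto
    then obtain top where top: "top \<in> C" "fst top = Max (fst ` C)" by auto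
    then have top: "top \<in> C" "\<And>b. b \<in> C \<Longrightarrow> fst b \<le> fst top"
      using fC by auto
    have "fst b \<le> fst (a - (1,1)) \<and> snd b \<le> snd (a - (1,1))" if "b \<in> C - {top}" for b
    proof -
      have "sw b top \<or> sw top b" using that top C(2) by (auto simp: totalp_on_def)
      then have "sw b top" using top(2)[of b] that by (auto simp: sw_def)
      then show ?thesis using C(3)[OF top(1)] by (auto simp: sw_def)
    qed
    then have "card (C - {top}) \<le> sw_height X (a - (1, 1))"
      using C totalp_on_subset[OF C(2)] by (intro sw_height_ge[OF X]) auto
    then show ?thesis using C(4) top(1) fC by simp
  qed
qed

text \<open>Any chain in the quadrant at \<open>a - (1, 1)\<close> lies strictly below
  \<open>a\<close> and can be prolonged by \<open>a\<close>. With \<open>sw_height_step\<close>, the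
  diagonal increment at points of \<open>X\<close> is exactly 1.\<close>

lemma sw_height_member:
  assumes X: "finite X" and a: "a \<in> X"
  shows "sw_height X (a - (1, 1)) + 1 \<le> sw_height X a"
proof -
  obtain C where C: "C \<subseteq> X" "totalp_on C sw"
    "\<And>b. b \<in> C \<Longrightarrow> fst b \<le> fst (a - (1,1)) \<and> snd b \<le> snd (a - (1,1))"
    "card C = sw_height X (a - (1,1))"
    using sw_height_obtain[OF assms(1)] by blast
  have b: "sw b a" if "b \<in> C" for b using C(3)[OF that] by (auto simp: sw_def)
  have "a \<notin> C" using b[of a] by (auto simp: sw_def)
  moreover have "totalp_on (insert a C) sw" using C(2) b by (auto simp: totalp_on_def)
  then have "card (insert a C) \<le> sw_height X a"
    using C a by (intro sw_height_ge[OF X]) force+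
  ultimately show ?thesis using C X finite_subset[OF C(1) X] by simp
qed

text \<open>\<open>d\<close> is the chain direction and \<open>e\<close> the transversal diagonal.
  By the last clause the increment along \<open>d\<close> majorizes the indicator function of
  \<open>X\<close>, while \<open>K\<close> bounds the total increment along any line.\<close>

definition lattice_potential ::
    "int \<times> int \<Rightarrow> int \<times> int \<Rightarrow> real \<Rightarrow> (int \<times> int) set \<Rightarrow> (int \<times> int \<Rightarrow> real) \<Rightarrow> bool" where
  "lattice_potential d e K X \<rho> \<longleftrightarrow>
     (\<forall>a. 0 \<le> \<rho> a \<and> \<rho> a \<le> K \<and> \<rho> (a - d) \<le> \<rho> a \<and> \<rho> a \<le> \<rho> (a - d) + 1 \<and>
          \<bar>\<rho> a - \<rho> (a - e)\<bar> \<le> 1 \<and> (a \<in> X \<longrightarrow> \<rho> a = \<rho> (a - d) + 1))"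

lemma lattice_potentialD:
  assumes "lattice_potential d e K X \<rho>"
  shows "0 \<le> \<rho> a" "\<rho> a \<le> K" "\<rho> (a - d) \<le> \<rho> a" "\<rho> a \<le> \<rho> (a - d) + 1"
    "\<bar>\<rho> a - \<rho> (a - e)\<bar> \<le> 1" "a \<in> X \<Longrightarrow> \<rho> a = \<rho> (a - d) + 1"
  using assms unfolding lattice_potential_def by blast+

lemma sw_potential:
  assumes X: "finite X" and k: "\<forall>C\<subseteq>X. totalp_on C sw \<longrightarrow> card C \<le> k"
  shows "\<exists>\<rho>. lattice_potential (1,1) (1,-1) (real k) X \<rho>"
  unfolding lattice_potential_def
proof (intro exI[of _ "\<lambda>a. real (sw_height X a)"] allI conjI impI)
  fix a :: "int \<times> int"
  show "real (sw_height X a) \<le> real k"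
    using sw_height_obtain[OF X, of a] k by (metis of_nat_le_iff)
  show "real (sw_height X (a - (1,1))) \<le> real (sw_height X a)"
    by (simp add: sw_height_mono[OF X])
  show "real (sw_height X a) \<le> real (sw_height X (a - (1,1))) + 1"
    using sw_height_step[OF X, of a] by linarith
  \<comment> \<open>Transversal bound: each of \<open>a\<close> and \<open>a - (1,-1)\<close> lies
    coordinatewise below the other one raised by \<open>(1,1)\<close>, so monotonicity and one
    diagonal step suffice.\<close>
  have "sw_height X (a - (1,-1)) \<le> sw_height X (a + (1,1))"
       "sw_height X (a + (1,1)) \<le> sw_height X a + 1"
       "sw_height X a \<le> sw_height X (a - (1,-1) + (1,1))"
       "sw_height X (a - (1,-1) + (1,1)) \<le> sw_height X (a - (1,-1)) + 1"
    using sw_height_step[OF X, of "a + (1,1)"] sw_height_step[OF X, of "a - (1,-1) + (1,1)"]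
    by (auto intro: sw_height_mono[OF X])
  then show "\<bar>real (sw_height X a) - real (sw_height X (a - (1,-1)))\<bar> \<le> 1" by linarith
  show "real (sw_height X a) = real (sw_height X (a - (1,1))) + 1" if "a \<in> X"
    using sw_height_step[OF X, of a] sw_height_member[OF X that] by linarith
qed simp

text \<open>Reflecting the second coordinate turns \<open>nw\<close>-chains into
  \<open>sw\<close>-chains and exchanges the two diagonals.\<close>

lemma nw_potential:
  assumes X: "finite X" and k: "\<forall>C\<subseteq>X. totalp_on C nw \<longrightarrow> card C \<le> k"
  shows "\<exists>\<rho>. lattice_potential (1,-1) (1,1) (real k) X \<rho>"
proof -
  define flip :: "int \<times> int \<Rightarrow> int \<times> int" where "flip a = (fst a, - snd a)" for a
  have ff: "flip (flip a) = a" for a by (simp add: flip_def)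
  have inj: "inj flip" by (metis ff injI)
  have k': "card C \<le> k" if "C \<subseteq> flip ` X" "totalp_on C sw" for C
  proof -
    have "flip ` C \<subseteq> X" using that(1) ff by force
    moreover have "totalp_on (flip ` C) nw"
      using that(2) unfolding totalp_on_def by (auto simp: nw_def sw_def flip_def)
    ultimately have "card (flip ` C) \<le> k" using k by simp
    then show ?thesis using inj by (simp add: card_image inj_on_subset)
  qed
  obtain \<rho> where \<rho>: "lattice_potential (1,1) (1,-1) (real k) (flip ` X) \<rho>"
    using sw_potential[OF finite_imageI[OF X, of flip], of k] k' by auto
  have fl: "flip (a - (1,-1)) = flip a - (1,1)" "flip (a - (1,1)) = flip a - (1,-1)" for a
    by (auto simp: flip_def minus_prod_def)
  show ?thesis
    unfolding lattice_potential_def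
    by (intro exI[of _ "\<lambda>a. \<rho> (flip a)"]) (use lattice_potentialD[OF \<rho>] fl in simp)
qed

section \<open>Summation by parts and the concentration bound on a lattice square\<close>

lemma sum_shift_lattice:
  fixes y w :: "int \<times> int \<Rightarrow> real"
  assumes y: "\<And>a. y a \<noteq> 0 \<Longrightarrow> 1 \<le> fst a \<and> fst a < M - 1 \<and> 1 \<le> snd a \<and> snd a < M - 1"
    and d: "\<bar>fst d\<bar> \<le> 1" "\<bar>snd d\<bar> \<le> 1"
  shows "(\<Sum>a\<in>{0..<M}\<times>{0..<M}. y (a + d) * w a) = (\<Sum>a\<in>{0..<M}\<times>{0..<M}. y a * w (a - d))"
\<comment> \<open>Only points with a nonzero value of \<open>y\<close> count, and the margin of one
  lattice point keeps them in the square after the shift.\<close>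
proof (rule sum.reindex_bij_witness_not_neutral[where i = "\<lambda>a. a - d" and j = "\<lambda>a. a + d"
      and S' = "{a \<in> {0..<M}\<times>{0..<M}. y (a + d) = 0}" and T' = "{a \<in> {0..<M}\<times>{0..<M}. y a = 0}"])
  fix a assume "a \<in> {0..<M}\<times>{0..<M} - {a \<in> {0..<M}\<times>{0..<M}. y (a + d) = 0}"
  then have "y (a + d) \<noteq> 0" by auto
  then show "a + d \<in> {0..<M}\<times>{0..<M} - {a \<in> {0..<M}\<times>{0..<M}. y a = 0}"
    using y[of "a + d"] by (cases a; cases d) auto
next
  fix a assume "a \<in> {0..<M}\<times>{0..<M} - {a \<in> {0..<M}\<times>{0..<M}. y a = 0}"
  then have "y a \<noteq> 0" by auto
  then show "a - d \<in> {0..<M}\<times>{0..<M} - {a \<in> {0..<M}\<times>{0..<M}. y (a + d) = 0}"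
    using y[of "a"] d by (cases a; cases d) auto
qed auto

text \<open>Differences in two directions commute: both sides equal the sum of \<open>y\<close>
  against the same mixed second difference of \<rho>.\<close>

lemma sum_by_parts_lattice:
  fixes y \<rho> :: "int \<times> int \<Rightarrow> real"
  assumes y: "\<And>a. y a \<noteq> 0 \<Longrightarrow> 1 \<le> fst a \<and> fst a < M - 1 \<and> 1 \<le> snd a \<and> snd a < M - 1"
    and d: "\<bar>fst d\<bar> \<le> 1" "\<bar>snd d\<bar> \<le> 1" and e: "\<bar>fst e\<bar> \<le> 1" "\<bar>snd e\<bar> \<le> 1"
  shows "(\<Sum>a\<in>{0..<M}\<times>{0..<M}. (y (a + e) - y a) * (\<rho> a - \<rho> (a - d))) =
         (\<Sum>a\<in>{0..<M}\<times>{0..<M}. (y (a + d) - y a) * (\<rho> a - \<rho> (a - e)))"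
proof -
  have *: "(\<Sum>a\<in>{0..<M}\<times>{0..<M}. (y (a + e) - y a) * w a) =
        (\<Sum>a\<in>{0..<M}\<times>{0..<M}. y a * (w (a - e) - w a))"
    if "\<bar>fst e\<bar> \<le> 1" "\<bar>snd e\<bar> \<le> 1" for e w
    using sum_shift_lattice[OF y that] by (simp add: left_diff_distrib right_diff_distrib sum_subtractf)
  show ?thesis
    unfolding *[OF d] *[OF e] by (intro sum.cong refl) (simp add: algebra_simps)
qed

text \<open>The sum telescopes along \<open>d\<close>. What survives is carried by the points of the
  square outside its translate by \<open>- d\<close>; they lie on two sides of the square, so there
  are at most \<open>2 * M\<close> of them.\<close>

lemma sum_lattice_diff_le:
  fixes \<rho> :: "int \<times> int \<Rightarrow> real"
  assumes \<rho>: "\<And>a. 0 \<le> \<rho> a" "\<And>a. \<rho> a \<le> K" and M: "M \<ge> 1" and d: "\<bar>fst d\<bar> = 1" "\<bar>snd d\<bar> = 1"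
  shows "(\<Sum>a\<in>{0..<M}\<times>{0..<M}. \<rho> a - \<rho> (a - d)) \<le> 2 * M * K"
proof -
  let ?Q = "{0..<M}\<times>{0..<M}"
  have K: "0 \<le> K" using \<rho> order_trans by blast
  define P where "P = (\<lambda>a. a - d) ` ?Q"
  define S where "S = ({if fst d = 1 then M - 1 else 0} \<times> {0..<M}) \<union> ({0..<M} \<times> {if snd d = 1 then M - 1 else 0})"
  have inj: "inj_on (\<lambda>a. a - d) ?Q" by (auto simp: inj_on_def)
  have sub: "?Q - P \<subseteq> S"
  proof
    fix a assume a: "a \<in> ?Q - P"
    have "a + d \<notin> ?Q" using a unfolding P_def by (metis DiffD2 add_diff_cancel_right' imageI)
    then show "a \<in> S" using a d unfolding S_def by (cases a; cases d) (auto split: if_splits)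
  qed
  have "card S \<le> nat M + nat M"
    unfolding S_def by (rule order_trans[OF card_Un_le]) (auto simp: card_cartesian_product)
  have "card (?Q - P) \<le> card S" by (intro card_mono sub) (auto simp: S_def)
  then have c: "real (card (?Q - P)) \<le> 2 * M" using \<open>card S \<le> _\<close> M by linarith
  have "(\<Sum>a\<in>?Q. \<rho> a - \<rho> (a - d)) = sum \<rho> ?Q - sum \<rho> P"
    unfolding P_def sum_subtractf sum.reindex[OF inj] by (simp add: o_def)
  also have "sum \<rho> ?Q = sum \<rho> (?Q - P) + sum \<rho> (?Q \<inter> P)"
    by (metis finite_SigmaI finite_atLeastLessThan_int sum.Int_Diff add.commute)
  also have "sum \<rho> (?Q \<inter> P) \<le> sum \<rho> P"
    by (intro sum_mono2) (auto simp: P_def \<rho>)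
  also have "sum \<rho> (?Q - P) \<le> card (?Q - P) * K"
    using \<rho> by (intro sum_bounded_above) auto
  also have "\<dots> \<le> 2 * M * K" using mult_right_mono[OF c K] by simp
  finally show ?thesis by simp
qed

text \<open>\<open>Z\<close> collects all errors at a lattice point. In the constants, 1/800 is
  (1/40) * (1/20), which makes the set \<open>s \<ge> 1\<close> small enough to be split into parts
  with chains of length at most \<open>M / 20\<close>. The value \<open>c / 10\<close> comes from
  \<open>c * M^2 \<le> c * M^2 / 5 + 8 * N\<close> for the total error \<open>N\<close>.\<close>

lemma lattice_concentration_bound:
  fixes s Z y y' :: "int \<times> int \<Rightarrow> real" and M :: int
  assumes c: "c > 0" and M: "M \<ge> 40"
    and y: "\<And>a. y a \<noteq> 0 \<Longrightarrow> 1 \<le> fst a \<and> fst a < M - 1 \<and> 1 \<le> snd a \<and> snd a < M - 1"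
    and y': "\<And>a. y' a \<noteq> 0 \<Longrightarrow> 1 \<le> fst a \<and> fst a < M - 1 \<and> 1 \<le> snd a \<and> snd a < M - 1"
    and Z: "\<And>a. a \<in> {0..<M}\<times>{0..<M} \<Longrightarrow> \<bar>M * (y (a + (1,1)) - y a)\<bar> \<le> Z a"
      "\<And>a. a \<in> {0..<M}\<times>{0..<M} \<Longrightarrow> \<bar>M * (y (a + (1,-1)) - y a) - (s a - c)\<bar> \<le> Z a"
      "\<And>a. a \<in> {0..<M}\<times>{0..<M} \<Longrightarrow> \<bar>M * (y' (a + (1,-1)) - y' a)\<bar> \<le> Z a"
      "\<And>a. a \<in> {0..<M}\<times>{0..<M} \<Longrightarrow> \<bar>M * (y' (a + (1,1)) - y' a) - (s a - c)\<bar> \<le> Z a"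
      "\<And>a. a \<in> {0..<M}\<times>{0..<M} \<Longrightarrow> - s a \<le> Z a"
      "\<And>a. a \<in> {0..<M}\<times>{0..<M} \<Longrightarrow> min (s a) 1 \<le> Z a"
  shows "min (1/800) (c/10) * (real_of_int M)\<^sup>2 \<le> (\<Sum>a\<in>{0..<M}\<times>{0..<M}. Z a)"
proof (rule ccontr)
  assume neg: "\<not> ?thesis"
  let ?Q = "{0..<M}\<times>{0..<M}"
  define N where "N = sum Z ?Q"
  have N: "N < (real_of_int M)\<^sup>2 / 800" "N < c / 10 * (real_of_int M)\<^sup>2"
  proof -
    have "N < min (1/800) (c/10) * (real_of_int M)\<^sup>2" using neg by (simp add: N_def)
    moreover have "min (1/800) (c/10) * (real_of_int M)\<^sup>2 \<le> 1/800 * (real_of_int M)\<^sup>2" "min (1/800) (c/10) * (real_of_int M)\<^sup>2 \<le> c/10 * (real_of_int M)\<^sup>2"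
      by (intro mult_right_mono; simp)+
    ultimately show "N < (real_of_int M)\<^sup>2 / 800" "N < c / 10 * (real_of_int M)\<^sup>2" by linarith+
  qed
  have Z0: "0 \<le> Z a" if "a \<in> ?Q" for a using Z(1)[OF that] by linarith
  define E where "E = {a \<in> ?Q. 1 \<le> s a}"
  have fE: "finite E" "E \<subseteq> ?Q" by (auto simp: E_def)
  have "real (card E) = (\<Sum>a\<in>E. 1)" by simp
  also have "\<dots> \<le> sum Z E" using Z(6) by (intro sum_mono) (force simp: E_def)
  also have "\<dots> \<le> N" unfolding N_def using fE Z0 by (intro sum_mono2) auto
  finally have cE: "real (card E) \<le> N" .
  \<comment> \<open>The lower bound \<open>M / 40 \<le> k\<close> uses \<open>M \<ge> 40\<close> and
    gives \<open>M^2 / 800 \<le> k * (k + 1)\<close>; the upper bound \<open>k \<le> M / 20\<close>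
    keeps the total increments of both potentials small.\<close>
  define k where "k = nat (M div 20)"
  have k: "real_of_int M / 40 \<le> real k" "real k \<le> real_of_int M / 20" "real_of_int M / 20 \<le> real k + 1"
  proof -
    have "int k = M div 20" using M by (simp add: k_def)
    then have *: "M < 20 * (int k + 1)" "20 * int k \<le> M"
      using div_mult_mod_eq[of M 20] pos_mod_bound[of 20 M] pos_mod_sign[of 20 M] by simp_all
    have "real_of_int M < 20 * (real k + 1)" "20 * real k \<le> real_of_int M"
      using *[folded of_int_less_iff[where 'a = real] of_int_le_iff[where 'a = real]] by simp_all
    then show "real_of_int M / 40 \<le> real k" "real k \<le> real_of_int M / 20" "real_of_int M / 20 \<le> real k + 1"
      using M by simp_all
  qed
  have "real (card E) \<le> (M / 40) * (M / 20)" using cE N(1) by (simp add: power2_eq_square)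
  also have "\<dots> \<le> real k * (real k + 1)" using k M by (intro mult_mono) auto
  also have "\<dots> = real (k * (k + 1))" by (simp add: algebra_simps)
  finally have "card E \<le> k * (k + 1)" by (simp only: of_nat_le_iff)
  from split_sw_nw[OF fE(1) this] obtain E' where E': "E' \<subseteq> E"
    "\<forall>C\<subseteq>E - E'. totalp_on C sw \<longrightarrow> card C \<le> k" "\<forall>C\<subseteq>E'. totalp_on C nw \<longrightarrow> card C \<le> k"
    by (elim exE conjE)
  have fE': "finite (E - E')" "finite E'" using finite_subset[OF E'(1) fE(1)] fE(1) by simp_all
  obtain \<rho> where "lattice_potential (1,1) (1,-1) (real k) (E - E') \<rho>"
    using sw_potential[OF fE'(1) E'(2)] by auto
  note \<rho> = lattice_potentialD[OF this]
  obtain \<rho>' where "lattice_potential (1,-1) (1,1) (real k) E' \<rho>'"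
    using nw_potential[OF fE'(2) E'(3)] by auto
  note \<rho>' = lattice_potentialD[OF this]
  define \<theta> where "\<theta> a = \<rho> a - \<rho> (a - (1,1))" for a
  define \<theta>' where "\<theta>' a = \<rho>' a - \<rho>' (a - (1,-1))" for a
  have \<theta>: "0 \<le> \<theta> a" "\<theta> a \<le> 1" "0 \<le> \<theta>' a" "\<theta>' a \<le> 1" for a
    using \<rho>(3,4)[of a] \<rho>'(3,4)[of a] by (auto simp: \<theta>_def \<theta>'_def)
  \<comment> \<open>One argument for both diagonals. The error \<open>2 * N\<close> arises once from
    replacing \<open>s - c\<close> by the difference quotient along \<open>e\<close>, and once from
    the difference quotient along \<open>d\<close> that appears after summation by parts.\<close>
  have main: "(\<Sum>a\<in>?Q. s a * T a) \<le> c * (\<Sum>a\<in>?Q. T a) + 2 * N"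
    if y: "\<And>a. y a \<noteq> 0 \<Longrightarrow> 1 \<le> fst a \<and> fst a < M - 1 \<and> 1 \<le> snd a \<and> snd a < M - 1"
      and d: "\<bar>fst d\<bar> \<le> 1" "\<bar>snd d\<bar> \<le> 1" and e: "\<bar>fst e\<bar> \<le> 1" "\<bar>snd e\<bar> \<le> 1"
      and Z1: "\<And>a. a \<in> ?Q \<Longrightarrow> \<bar>M * (y (a + d) - y a)\<bar> \<le> Z a"
      and Z2: "\<And>a. a \<in> ?Q \<Longrightarrow> \<bar>M * (y (a + e) - y a) - (s a - c)\<bar> \<le> Z a"
      and t: "\<And>a. T a = \<rho> a - \<rho> (a - d)" "\<And>a. 0 \<le> T a" "\<And>a. T a \<le> 1"
      and r: "\<And>a. \<bar>\<rho> a - \<rho> (a - e)\<bar> \<le> 1"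
    for y \<rho> T :: "int \<times> int \<Rightarrow> real" and d e :: "int \<times> int"
  proof -
    have "(\<Sum>a\<in>?Q. (s a - c) * T a) \<le> (\<Sum>a\<in>?Q. M * (y (a + e) - y a) * T a + Z a)"
    proof (rule sum_mono)
      fix a assume a: "a \<in> ?Q"
      have "(s a - c - M * (y (a + e) - y a)) * T a \<le> Z a * 1"
        using Z2[OF a] t(2,3)[of a] Z0[OF a] by (intro mult_mono) auto
      then show "(s a - c) * T a \<le> M * (y (a + e) - y a) * T a + Z a"
        by (simp add: algebra_simps)
    qed
    also have "\<dots> = M * (\<Sum>a\<in>?Q. (y (a + e) - y a) * T a) + N"
      by (simp add: sum.distrib N_def sum_distrib_left mult.assoc)
    also have "(\<Sum>a\<in>?Q. (y (a + e) - y a) * T a) = (\<Sum>a\<in>?Q. (y (a + d) - y a) * (\<rho> a - \<rho> (a - e)))"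
      unfolding t(1) by (rule sum_by_parts_lattice[OF y d e])
    also have "M * \<dots> = (\<Sum>a\<in>?Q. (M * (y (a + d) - y a)) * (\<rho> a - \<rho> (a - e)))"
      by (simp add: sum_distrib_left mult.assoc)
    also have "\<dots> \<le> (\<Sum>a\<in>?Q. Z a)"
    proof (rule sum_mono)
      fix a assume a: "a \<in> ?Q"
      have "\<bar>(M * (y (a + d) - y a)) * (\<rho> a - \<rho> (a - e))\<bar> \<le> Z a * 1"
        unfolding abs_mult using Z1[OF a] r[of a] Z0[OF a] by (intro mult_mono) (auto simp: abs_mult)
      then show "(M * (y (a + d) - y a)) * (\<rho> a - \<rho> (a - e)) \<le> Z a" by linarith
    qed
    finally show ?thesis by (simp add: N_def left_diff_distrib sum_subtractf sum_distrib_left)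
  qed
  have m1: "(\<Sum>a\<in>?Q. s a * \<theta> a) \<le> c * (\<Sum>a\<in>?Q. \<theta> a) + 2 * N"
    by (rule main[where \<rho> = \<rho> and d = "(1,1)" and e = "(1,-1)", OF y]) (use Z \<rho> \<theta> in \<open>auto simp: \<theta>_def\<close>)
  have m2: "(\<Sum>a\<in>?Q. s a * \<theta>' a) \<le> c * (\<Sum>a\<in>?Q. \<theta>' a) + 2 * N"
    by (rule main[where \<rho> = \<rho>' and d = "(1,-1)" and e = "(1,1)", OF y']) (use Z \<rho>' \<theta> in \<open>auto simp: \<theta>'_def\<close>)
  have t1: "(\<Sum>a\<in>?Q. \<theta> a) \<le> 2 * real_of_int M * real k"
    unfolding \<theta>_def by (rule sum_lattice_diff_le) (use \<rho> M in auto)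
  have t2: "(\<Sum>a\<in>?Q. \<theta>' a) \<le> 2 * real_of_int M * real k"
    unfolding \<theta>'_def by (rule sum_lattice_diff_le) (use \<rho>' M in auto)
  \<comment> \<open>The differences of the compactly supported \<open>y\<close> sum to zero; hence
    the mean of \<open>s\<close> over the square is at least \<open>c\<close> up to the error
    \<open>N\<close>.\<close>
  have "(\<Sum>a\<in>?Q. M * (y (a + (1,-1)) - y a)) = M * ((\<Sum>a\<in>?Q. y (a + (1,-1)) * 1) - (\<Sum>a\<in>?Q. y a * 1))"
    by (simp add: sum_distrib_left[symmetric] sum_subtractf)
  also have "\<dots> = 0" by (subst sum_shift_lattice[OF y, where w = "\<lambda>_. 1"]) auto
  finally have A0: "(\<Sum>a\<in>?Q. M * (y (a + (1,-1)) - y a)) = 0" .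
  have "(\<Sum>a\<in>?Q. M * (y (a + (1,-1)) - y a)) \<le> (\<Sum>a\<in>?Q. (s a - c) + Z a)"
    using Z(2) by (intro sum_mono) force
  then have "c * (real_of_int M)\<^sup>2 \<le> sum s ?Q + N"
    using A0 M by (simp add: sum.distrib sum_subtractf N_def card_cartesian_product power2_eq_square algebra_simps)
  \<comment> \<open>On \<open>E\<close> one of the two increments equals 1 and \<open>s\<close> is
    positive; off \<open>E\<close> the values of \<open>s\<close> are themselves errors, and each of
    the three occurrences of \<open>s a\<close> costs one \<open>Z a\<close>.\<close>
  also have "sum s ?Q \<le> (\<Sum>a\<in>?Q. s a * \<theta> a + s a * \<theta>' a + 3 * Z a)"
  proof (rule sum_mono)
    fix a assume a: "a \<in> ?Q"
    show "s a \<le> s a * \<theta> a + s a * \<theta>' a + 3 * Z a"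
    proof (cases "a \<in> E")
      case True
      then have "1 \<le> \<theta> a + \<theta>' a"
        using \<rho>(6)[of a] \<rho>'(6)[of a] \<theta>[of a] by (cases "a \<in> E'") (auto simp: \<theta>_def \<theta>'_def)
      then have "s a * 1 \<le> s a * (\<theta> a + \<theta>' a)" using True by (intro mult_left_mono) (auto simp: E_def)
      then show ?thesis using Z0[OF a] by (simp add: algebra_simps)
    next
      case False
      then have "s a < 1" using a by (auto simp: E_def)
      then have sa: "\<bar>s a\<bar> \<le> Z a" using Z(5,6)[OF a] by auto
      have "\<bar>s a * \<theta> a\<bar> \<le> Z a * 1" "\<bar>s a * \<theta>' a\<bar> \<le> Z a * 1"
        unfolding abs_mult using sa \<theta>[of a] Z0[OF a] by (intro mult_mono; simp)+
      then show ?thesis using sa by linarith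
    qed
  qed
  also have "\<dots> = (\<Sum>a\<in>?Q. s a * \<theta> a) + (\<Sum>a\<in>?Q. s a * \<theta>' a) + 3 * N"
    by (simp add: sum.distrib N_def sum_distrib_left)
  also have "\<dots> \<le> c * (2 * real_of_int M * real k) + c * (2 * real_of_int M * real k) + 7 * N"
    using m1 m2 mult_left_mono[OF t1, of c] mult_left_mono[OF t2, of c] c by linarith
  finally have fin: "c * (real_of_int M)\<^sup>2 \<le> c * (2 * real_of_int M * real k) + c * (2 * real_of_int M * real k) + 8 * N" by simp
  \<comment> \<open>Each potential contributes at most a tenth of \<open>c * M^2\<close>, so four
    fifths of \<open>c * M^2\<close> remain to be paid by the eight copies of
    \<open>N\<close>.\<close>
  have "c * (2 * real_of_int M * real k) \<le> c * (2 * real_of_int M * (M / 20))"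
    using c M k by (intro mult_left_mono) auto
  then have "c * (real_of_int M)\<^sup>2 \<le> c * (real_of_int M)\<^sup>2 / 5 + 8 * N" using fin by (simp add: power2_eq_square)
  then show False using N(2) by simp
qed

subsection \<open>The convex envelope\<close>

definition huber :: "real \<Rightarrow> 'a::real_inner \<Rightarrow> real" where
  "huber l x = (if norm x \<le> l / 2 then (norm x)\<^sup>2 else l * norm x - l\<^sup>2 / 4)"

text \<open>This is the gradient of \<open>huber\<close>: the linear branch is the tangent of the
  square at radius \<open>l / 2\<close>, so the two formulas agree there.\<close>

definition huber_slope :: "real \<Rightarrow> 'a::real_inner \<Rightarrow> 'a" where
  "huber_slope l x = (if norm x \<le> l / 2 then 2 *\<^sub>R x else (l / norm x) *\<^sub>R x)"

lemma affine_le_square: "l * r - l\<^sup>2 / 4 \<le> r\<^sup>2" for l r :: real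
proof -
  have "0 \<le> (r - l / 2)\<^sup>2" by simp
  then show ?thesis by (simp add: power2_eq_square algebra_simps)
qed

lemma huber_ge_affine: "l * norm x - l\<^sup>2 / 4 \<le> huber l x"
  by (simp add: huber_def affine_le_square)

lemma huber_subgradient:
  assumes l: "l > 0"
  shows "huber l x + huber_slope l x \<bullet> (y - x) \<le> huber l y"
proof (cases "norm x \<le> l / 2")
  case x: True
  have xx: "x \<bullet> x = (norm x)\<^sup>2" by (simp add: power2_norm_eq_inner)
  have xy: "x \<bullet> y \<le> norm x * norm y" by (rule norm_cauchy_schwarz)
  have eq: "huber l x + huber_slope l x \<bullet> (y - x) = 2 * (x \<bullet> y) - (norm x)\<^sup>2"
    using x by (simp add: huber_def huber_slope_def xx inner_diff_right)
  show ?thesis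
  proof (cases "norm y \<le> l / 2")
    case True
    have "0 \<le> (norm x - norm y)\<^sup>2" by simp
    then have "2 * (norm x * norm y) - (norm x)\<^sup>2 \<le> (norm y)\<^sup>2"
      by (simp add: power2_eq_square algebra_simps)
    then show ?thesis using True eq xy by (simp add: huber_def)
  next
    case False
    \<comment> \<open>The product is exactly the difference of the two sides of the inequality
      derived next.\<close>
    have "0 \<le> (l / 2 - norm x) * (2 * norm y - l / 2 - norm x)"
      using x False by (intro mult_nonneg_nonneg) auto
    then have "2 * (norm x * norm y) - (norm x)\<^sup>2 \<le> l * norm y - l\<^sup>2 / 4"
      by (simp add: power2_eq_square algebra_simps)
    then show ?thesis using False eq xy by (simp add: huber_def)
  qed
next
  case x: False
  then have nx: "norm x > 0" using l by linarith
  have "(l / norm x) * (x \<bullet> y) \<le> (l / norm x) * (norm x * norm y)"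
    using l by (intro mult_left_mono norm_cauchy_schwarz) auto
  also have "\<dots> = l * norm y" using nx by simp
  finally have "(l / norm x) * (x \<bullet> y) \<le> l * norm y" .
  moreover have "(l / norm x) * (x \<bullet> x) = l * norm x"
    using nx by (simp add: power2_norm_eq_inner[symmetric] power2_eq_square)
  ultimately have "huber l x + huber_slope l x \<bullet> (y - x) \<le> l * norm y - l\<^sup>2 / 4"
    using x by (simp add: huber_def huber_slope_def inner_diff_right algebra_simps)
  then show ?thesis using huber_ge_affine[of l y] by linarith
qed

lemma convex_on_huber:
  assumes "l > 0"
  shows "convex_on UNIV (huber l :: 'a::real_inner \<Rightarrow> real)"
proof (rule convex_onI)
  fix t :: real and x y :: 'a
  assume t: "0 < t" "t < 1"
  define z where "z = (1 - t) *\<^sub>R x + t *\<^sub>R y"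
  let ?L = "huber_slope l z"
  have "(1 - t) * (huber l z + ?L \<bullet> (x - z)) + t * (huber l z + ?L \<bullet> (y - z)) \<le> (1 - t) * huber l x + t * huber l y"
    using t huber_subgradient[OF assms] by (intro add_mono mult_left_mono) auto
  moreover have "(1 - t) *\<^sub>R (x - z) + t *\<^sub>R (y - z) = 0" by (simp add: z_def algebra_simps)
  then have "?L \<bullet> ((1 - t) *\<^sub>R (x - z) + t *\<^sub>R (y - z)) = 0" by simp
  then have "(1 - t) * (?L \<bullet> (x - z)) + t * (?L \<bullet> (y - z)) = 0"
    by (simp add: inner_add_right)
  ultimately show "huber l ((1 - t) *\<^sub>R x + t *\<^sub>R y) \<le> (1 - t) * huber l x + t * huber l y"
    unfolding z_def[symmetric] by (simp add: algebra_simps)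
qed simp

lemma huber_le_h_simp: "l > 0 \<Longrightarrow> huber l \<xi> \<le> h_simp l \<xi>"
proof (cases "norm \<xi> \<le> l / 2")
  case True
  assume l: "l > 0"
  have "norm \<xi> * norm \<xi> \<le> l * norm \<xi>" using True l by (intro mult_right_mono) auto
  then show ?thesis using True by (simp add: huber_def h_simp_def power2_eq_square)
next
  case False
  then show ?thesis using affine_le_square[of l "norm \<xi>"]
    by (simp add: huber_def h_simp_def)
qed

lemma h_simp_eq_huber: "l > 0 \<Longrightarrow> norm \<xi> \<le> l / 2 \<Longrightarrow> h_simp l \<xi> = huber l \<xi>"
  using huber_le_h_simp[of l \<xi>] by (simp add: huber_def h_simp_def)

text \<open>On the ray through \<xi>, combine the point at radius \<open>l / 2\<close>, where the
  quadratic bound holds, with a far point of weight \<open>t\<close>, where the bound of slope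
  \<open>l\<close> holds. As \<open>t\<close> tends to 0 the far point escapes to infinity and the
  chord bound becomes the tangent line.\<close>

lemma convex_le_huber:
  fixes \<xi> :: "real^'n^'m"
  assumes l: "l > 0" and g: "convex_on UNIV g" "g \<le> h_simp l"
  shows "g \<xi> \<le> huber l \<xi>"
proof (cases "norm \<xi> \<le> l / 2")
  case True
  then show ?thesis using h_simp_eq_huber[OF l True] le_funD[OF g(2), of \<xi>] by simp
next
  case False
  define e where "e = \<xi> /\<^sub>R norm \<xi>"
  have "norm \<xi> \<noteq> 0" using False l by linarith
  then have ne: "norm e = 1" by (simp add: e_def)
  have xe: "\<xi> = norm \<xi> *\<^sub>R e" using \<open>norm \<xi> \<noteq> 0\<close> by (simp add: e_def)
  have bound: "g \<xi> \<le> l * norm \<xi> - (1 - t) * (l\<^sup>2 / 4)" if t: "0 < t" "t < 1" for t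
  proof -
    \<comment> \<open>The radius forced by writing \<xi> as this convex combination.\<close>
    define R where "R = (norm \<xi> - (1 - t) * (l / 2)) / t"
    have "(1 - t) * (l / 2) \<le> 1 * (l / 2)" using t l by (intro mult_right_mono) auto
    then have R0: "0 \<le> R" using False t unfolding R_def by (intro divide_nonneg_pos) auto
    have tR: "t * R = norm \<xi> - (1 - t) * (l / 2)" using t by (simp add: R_def)
    have "\<xi> = (1 - t) *\<^sub>R ((l / 2) *\<^sub>R e) + t *\<^sub>R (R *\<^sub>R e)"
      by (subst xe) (simp add: scaleR_add_left[symmetric] tR)
    then have "g \<xi> \<le> (1 - t) * g ((l / 2) *\<^sub>R e) + t * g (R *\<^sub>R e)"
      using convex_onD[OF g(1), of t "(l / 2) *\<^sub>R e" "R *\<^sub>R e"] t by simp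
    also have "\<dots> \<le> (1 - t) * (l / 2)\<^sup>2 + t * (l * R)"
    proof (intro add_mono mult_left_mono)
      have "g ((l / 2) *\<^sub>R e) \<le> h_simp l ((l / 2) *\<^sub>R e)" "g (R *\<^sub>R e) \<le> h_simp l (R *\<^sub>R e)"
        using g(2) by (simp_all add: le_fun_def)
      then show "g ((l / 2) *\<^sub>R e) \<le> (l / 2)\<^sup>2" "g (R *\<^sub>R e) \<le> l * R"
        using l R0 ne by (simp_all add: h_simp_def)
    qed (use t in auto)
    also have "t * (l * R) = l * (norm \<xi> - (1 - t) * (l / 2))" using tR by (metis mult.left_commute)
    finally show ?thesis by (simp add: power2_eq_square field_simps)
  qed
  have "((\<lambda>t. l * norm \<xi> - (1 - t) * (l\<^sup>2 / 4)) \<longlongrightarrow> l * norm \<xi> - (1 - 0) * (l\<^sup>2 / 4)) (at_right 0)"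
    by (intro tendsto_intros)
  moreover have "eventually (\<lambda>t. g \<xi> \<le> l * norm \<xi> - (1 - t) * (l\<^sup>2 / 4)) (at_right 0)"
    using bound by (auto simp: eventually_at_right_field intro!: exI[of _ 1])
  ultimately have "g \<xi> \<le> l * norm \<xi> - (1 - 0) * (l\<^sup>2 / 4)"
    using tendsto_lowerbound trivial_limit_at_right_real by blast
  then show ?thesis using False by (simp add: huber_def)
qed

lemma convex_envelope_h_simp:
  fixes \<xi> :: "real^'n^'m"
  assumes l: "l > 0"
  shows "convex_envelope (h_simp l) \<xi> = huber l \<xi>"
proof (rule antisym)
  have le: "huber l \<le> (h_simp l :: real^'n^'m \<Rightarrow> real)"
    by (intro le_funI huber_le_h_simp[OF l])
  note * = convex_envelope_greatest[OF convex_on_huber[OF l] le]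
  show "convex_envelope (h_simp l) \<xi> \<le> huber l \<xi>" by (rule convex_le_huber[OF l *(1,2)])
  show "huber l \<xi> \<le> convex_envelope (h_simp l) \<xi>"
    by (rule le_funD[OF *(3)[OF convex_on_huber[OF l] le]])
qed

text \<open>Here \<open>\<sigma>\<close> is the component of a matrix of norm \<open>r\<close> along the unit matrix \<open>\<xi> / norm \<xi>\<close>, and \<open>p\<close>
  the norm of its orthogonal part. The term \<open>\<tau> * \<sigma>\<close> is needed because for large \<open>\<sigma>\<close> the excess \<open>D\<close> controls
  only \<open>p\<^sup>2 / \<sigma>\<close>; it is harmless because \<open>\<sigma>\<close> has mean \<open>norm \<xi>\<close>.\<close>

lemma excess_bound:
  fixes \<sigma> p l \<tau> :: real
  assumes l: "l > 0" and \<tau>: "0 < \<tau>" and p: "0 \<le> p"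
    and r: "0 \<le> r" "r\<^sup>2 = \<sigma>\<^sup>2 + p\<^sup>2" and D: "D = min (r\<^sup>2) (l * r) - l\<^sup>2 / 4 - l * (\<sigma> - l / 2)"
  shows "p + max 0 (l / 2 - \<sigma>) + min (max 0 (\<sigma> - l / 2)) 1
    \<le> \<tau> * (1 + l + \<sigma>) + (1 / (2 * \<tau>) + 4 / l\<^sup>2 + 2 / l + (1 + 1 / \<tau> + \<tau>) / l) * D"
proof (cases "r \<le> l")
  case True
  \<comment> \<open>Young's inequality: the excess is quadratic in this regime but a bound on first
    powers is wanted, at the price of an additive term in \<tau>.\<close>
  have am: "x \<le> \<tau> / 2 + x\<^sup>2 / (2 * \<tau>)" for x
  proof -
    have "0 \<le> (x - \<tau>)\<^sup>2 / (2 * \<tau>)" using \<tau> by simp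
    also have "\<dots> = x\<^sup>2 / (2 * \<tau>) - x + \<tau> / 2" using \<tau> by (simp add: power2_eq_square field_simps)
    finally show ?thesis by simp
  qed
  have "r * r \<le> l * r" using True r by (intro mult_right_mono) auto
  then have D': "D = (\<sigma> - l / 2)\<^sup>2 + p\<^sup>2"
    unfolding D using r by (simp add: power2_eq_square algebra_simps)
  have "\<bar>\<sigma>\<bar> \<le> \<bar>r\<bar>" unfolding abs_le_square_iff r(2) by simp
  then have "\<bar>\<sigma>\<bar> \<le> r" using r(1) by simp
  then have "\<tau> * 1 \<le> \<tau> * (1 + l + \<sigma>)" using True \<tau> by (intro mult_left_mono) auto
  moreover have "p + \<bar>\<sigma> - l / 2\<bar> \<le> \<tau> + 1 / (2 * \<tau>) * D"
    using am[of p] am[of "\<bar>\<sigma> - l / 2\<bar>"] unfolding D' by (simp add: add_divide_distrib)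
  moreover have "1 / (2 * \<tau>) * D \<le> (1 / (2 * \<tau>) + 4 / l\<^sup>2 + 2 / l + (1 + 1 / \<tau> + \<tau>) / l) * D"
  proof (rule mult_right_mono)
    have "0 \<le> 4 / l\<^sup>2 + 2 / l + (1 + 1 / \<tau> + \<tau>) / l"
      using l \<tau> by (intro add_nonneg_nonneg divide_nonneg_pos) auto
    then show "1 / (2 * \<tau>) \<le> 1 / (2 * \<tau>) + 4 / l\<^sup>2 + 2 / l + (1 + 1 / \<tau> + \<tau>) / l" by linarith
  qed (simp add: D')
  moreover have "min (max 0 (\<sigma> - l / 2)) 1 + max 0 (l / 2 - \<sigma>) \<le> \<bar>\<sigma> - l / 2\<bar>" by auto
  ultimately show ?thesis by argo
next
  case False
  then have "l * r \<le> r * r" using l by (intro mult_right_mono) auto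
  then have D': "D = l * (r - \<sigma> + l / 4)"
    unfolding D by (simp add: power2_eq_square algebra_simps)
  \<comment> \<open>Since \<delta> is at least \<open>l / 4\<close>, bounded quantities are
    multiples of the excess \<open>l * \<delta>\<close>. The facts \<open>1\<close>,
    \<open>2\<close>, \<open>3\<close> produce the summands \<open>4 / l^2\<close>,
    \<open>2 / l\<close> and \<open>(1 + 1 / \<tau> + \<tau>) / l\<close> of the constant.\<close>
  define \<delta> where "\<delta> = r - \<sigma> + l / 4"
  have "\<bar>\<sigma>\<bar> \<le> \<bar>r\<bar>" "\<bar>p\<bar> \<le> \<bar>r\<bar>" unfolding abs_le_square_iff r(2) by simp_all
  then have \<sigma>: "\<bar>\<sigma>\<bar> \<le> r" and pr: "p \<le> r" using r(1) by simp_all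
  have \<delta>: "l / 4 \<le> \<delta>" "D = l * \<delta>" using \<sigma> D' by (auto simp: \<delta>_def)
  have "1 \<le> 4 / l * \<delta>" using \<delta> l by (simp add: field_simps)
  then have 1: "min (max 0 (\<sigma> - l / 2)) 1 \<le> 4 / l * \<delta>" by linarith
  have 2: "max 0 (l / 2 - \<sigma>) \<le> 2 * \<delta>" using \<sigma> l by (auto simp: \<delta>_def)
  have 3: "p \<le> \<tau> * \<sigma> + (1 + 1 / \<tau> + \<tau>) * \<delta>"
  proof (cases "0 \<le> \<sigma>")
    case True
    \<comment> \<open>The first factor is at most \<delta> but the second grows like
      \<open>2 * \<sigma>\<close>. Their product contains \<open>2 * \<sigma> * \<delta>\<close>,
      the mixed term of the square of \<open>\<tau> * \<sigma> + \<delta> / \<tau>\<close>.\<close>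
    have "p\<^sup>2 = (r - \<sigma>) * (r + \<sigma>)" using r by (simp add: power2_eq_square algebra_simps)
    also have "\<dots> \<le> \<delta> * (2 * \<sigma> + \<delta>)"
      using \<sigma> l True r by (intro mult_mono) (auto simp: \<delta>_def)
    also have "\<dots> \<le> (\<tau> * \<sigma> + (1 / \<tau>) * \<delta> + \<delta>)\<^sup>2"
    proof -
      have "(\<tau> * \<sigma> + (1 / \<tau>) * \<delta> + \<delta>)\<^sup>2 = \<delta> * (2 * \<sigma> + \<delta>) +
          ((\<tau> * \<sigma>)\<^sup>2 + ((1 / \<tau>) * \<delta>)\<^sup>2 + 2 * (\<tau> * \<sigma>) * \<delta> + 2 * ((1 / \<tau>) * \<delta>) * \<delta>)"
        using \<tau> by (simp add: power2_eq_square field_simps)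
      moreover have "0 \<le> (\<tau> * \<sigma>)\<^sup>2 + ((1 / \<tau>) * \<delta>)\<^sup>2 + 2 * (\<tau> * \<sigma>) * \<delta> + 2 * ((1 / \<tau>) * \<delta>) * \<delta>"
        using True \<tau> \<delta>(1) l by (intro add_nonneg_nonneg mult_nonneg_nonneg) auto
      ultimately show ?thesis by linarith
    qed
    finally have "p \<le> \<tau> * \<sigma> + (1 / \<tau>) * \<delta> + \<delta>"
      by (rule power2_le_imp_le) (use True \<tau> \<delta>(1) l in auto)
    moreover have "0 \<le> \<tau> * \<delta>" using \<tau> \<delta>(1) l by simp
    ultimately show ?thesis by (simp add: algebra_simps)
  next
    case False
    then have "- \<sigma> \<le> \<delta>" "p \<le> \<delta>" using \<sigma> pr l by (auto simp: \<delta>_def)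
    then have "\<tau> * (- \<sigma>) \<le> \<tau> * \<delta>" using \<tau> by (intro mult_left_mono) auto
    moreover have "0 \<le> (1 / \<tau>) * \<delta>" using \<tau> \<delta>(1) l by simp
    ultimately show ?thesis using \<open>p \<le> \<delta>\<close> by (simp add: algebra_simps)
  qed
  have "(1 / (2 * \<tau>) + 4 / l\<^sup>2 + 2 / l + (1 + 1 / \<tau> + \<tau>) / l) * D =
     (1 / (2 * \<tau>)) * D + 4 / l * \<delta> + 2 * \<delta> + (1 + 1 / \<tau> + \<tau>) * \<delta>"
  proof -
    have *: "X / l * (l * \<delta>) = X * \<delta>" for X using l by simp
    have **: "4 / l\<^sup>2 * (l * \<delta>) = 4 / l * \<delta>" using l by (simp add: power2_eq_square)
    show ?thesis
      unfolding \<delta>(2) distrib_right[of _ _ "l * \<delta>"] * ** by (simp only: mult.assoc)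
  qed
  moreover have "0 \<le> (1 / (2 * \<tau>)) * D" using \<tau> \<delta> l by simp
  moreover have "0 \<le> \<tau> * (1 + l)" using \<tau> l by simp
  then have "\<tau> * \<sigma> \<le> \<tau> * (1 + l + \<sigma>)" by (simp add: algebra_simps)
  ultimately show ?thesis using 1 2 3 by linarith
qed

subsection \<open>Test functions on the unit cube\<close>

lemma unit_cube_eq_box: "(unit_cube :: (real^'n) set) = box 0 1"
  by (auto simp: unit_cube_def mem_box_cart)

lemma measure_unit_cube [simp]: "measure lborel (unit_cube :: (real^'n) set) = 1"
proof -
  have "measure lborel (box 0 (1 :: real^'n)) = 1"
    by (subst measure_lborel_box) (auto simp: Basis_vec_def inner_axis intro!: prod.cong prod.neutral)
  then show ?thesis by (simp add: unit_cube_eq_box)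
qed

lemma unit_cube_borel [measurable]: "(unit_cube :: (real^'n) set) \<in> sets borel"
  by (simp add: unit_cube_eq_box)

lemma emeasure_unit_cube_finite: "emeasure lborel (unit_cube :: (real^'n) set) < \<infinity>"
  unfolding unit_cube_eq_box by (rule emeasure_bounded_finite[OF bounded_box])

lemma set_integrable_unit_cube:
  fixes f :: "real^'n \<Rightarrow> real"
  assumes "continuous_on UNIV f"
  shows "set_integrable lborel unit_cube f"
proof (rule set_integrable_subset)
  show "set_integrable lborel (cbox 0 1) f"
    unfolding set_integrable_def
    by (rule borel_integrable_compact) (use assms continuous_on_subset in auto)
  show "unit_cube \<subseteq> cbox (0 :: real^'n) 1"
    by (auto simp: unit_cube_def mem_box_cart less_imp_le)
qed auto

lemma set_integral_unit_cube_const [simp]: "(LINT x:(unit_cube :: (real^'n) set)|lborel. c) = (c::real)"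
  using emeasure_unit_cube_finite[where 'n = 'n] by (subst set_integral_const) simp_all

context
  fixes \<phi> :: "real^'n \<Rightarrow> real^'m" and U :: "(real^'n) set"
  assumes tf: "\<phi> \<in> test_functions U"
begin

lemma test_function_compact: "compact (closure {x. \<phi> x \<noteq> 0})" "closure {x. \<phi> x \<noteq> 0} \<subseteq> U"
  using tf by (auto simp: test_functions_def)

lemma test_function_C1: "C_order (Suc 0) \<phi>"
  using tf by (simp add: test_functions_def smooth_def del: C_order.simps)

lemma test_function_has_derivative: "(\<phi> has_derivative (\<lambda>h. jacobian \<phi> (at x) *v h)) (at x)"
  using test_function_C1 by (simp add: jacobian_works[symmetric])

lemma test_function_component_derivative:
  "((\<lambda>x. a \<bullet> \<phi> x) has_derivative (\<lambda>h. (a v* jacobian \<phi> (at x)) \<bullet> h)) (at x)"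
proof -
  have "((\<lambda>x. a \<bullet> \<phi> x) has_derivative (\<lambda>h. a \<bullet> (jacobian \<phi> (at x) *v h))) (at x)"
    by (intro derivative_intros test_function_has_derivative)
  then show ?thesis by (simp add: dot_lmul_matrix)
qed

lemma test_function_zero: "x \<notin> closure {x. \<phi> x \<noteq> 0} \<Longrightarrow> \<phi> x = 0"
  using subsetD[OF closure_subset[of "{x. \<phi> x \<noteq> 0}"], of x] by auto

lemma test_function_jacobian_zero:
  assumes x: "x \<notin> closure {x. \<phi> x \<noteq> 0}"
  shows "jacobian \<phi> (at x) = 0"
proof -
  have "open (- closure {x. \<phi> x \<noteq> 0})" by (rule open_Compl[OF closed_closure])
  moreover have "x \<in> - closure {x. \<phi> x \<noteq> 0}" using x by (simp only: Compl_iff not_False_eq_True)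
  moreover have "\<phi> z = 0" if "z \<in> - closure {x. \<phi> x \<noteq> 0}" for z
    by (rule test_function_zero[OF ComplD[OF that]])
  ultimately have "((\<lambda>_. 0) has_derivative (\<lambda>h. jacobian \<phi> (at x) *v h)) (at x)"
    by (rule has_derivative_transform_within_open[OF test_function_has_derivative])
  then have "(\<lambda>h. jacobian \<phi> (at x) *v h) = (\<lambda>h. 0)"
    using has_derivative_unique has_derivative_const by blast
  then show ?thesis by (metis matrix_eq matrix_vector_mult_0)
qed

lemma test_function_jacobian_continuous: "continuous_on UNIV (\<lambda>x. jacobian \<phi> (at x))"
proof -
  have "continuous_on UNIV (\<lambda>x. frechet_derivative \<phi> (at x) (axis j 1))" for j
    using test_function_C1 by simp
  then show ?thesis
    unfolding jacobian_def matrix_def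
    by (intro continuous_on_vec_lambda continuous_on_component) auto
qed

end

section \<open>Gradients of compactly supported functions have mean zero\<close>

lemma uniform_difference_quotient:
  fixes y :: "'a::euclidean_space \<Rightarrow> real"
  assumes y: "\<And>x. (y has_derivative (\<lambda>h. G x \<bullet> h)) (at x)"
    and G: "continuous_on UNIV G" "\<And>x. x \<notin> K \<Longrightarrow> G x = 0" "compact K" and \<omega>: "\<omega> > 0"
  obtains h0 where "h0 > 0" "\<And>h x. 0 < h \<Longrightarrow> h < h0 \<Longrightarrow> \<bar>(y (x + h *\<^sub>R d) - y x) / h - G x \<bullet> d\<bar> \<le> \<omega>"
proof -
  obtain R where R: "K \<subseteq> ball 0 R" using bounded_subset_ballD[OF compact_imp_bounded[OF G(3)], of 0] by blast
  have "uniformly_continuous_on (cball 0 (R + 1)) G"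
    using G(1) by (intro compact_uniformly_continuous) (auto intro: continuous_on_subset)
  moreover have "\<omega> / (norm d + 1) > 0" using \<omega> by (simp add: add_nonneg_pos)
  ultimately obtain \<delta> where \<delta>: "\<delta> > 0"
    "\<And>x z. x \<in> cball 0 (R + 1) \<Longrightarrow> z \<in> cball 0 (R + 1) \<Longrightarrow> dist z x < \<delta> \<Longrightarrow> dist (G z) (G x) < \<omega> / (norm d + 1)"
    unfolding uniformly_continuous_on_def by metis
  \<comment> \<open>Inside the enlarged ball this is uniform continuity. Two points at distance
    below 1, one of them outside that ball, both miss \<open>K\<close>, where \<open>G\<close>
    lives.\<close>
  have unif: "norm (G z - G x) \<le> \<omega> / (norm d + 1)" if "norm (z - x) < min \<delta> 1" for x z
  proof (cases "x \<in> cball 0 (R + 1) \<and> z \<in> cball 0 (R + 1)")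
    case True
    then show ?thesis using \<delta>(2)[of x z] that by (simp add: dist_norm)
  next
    case False
    have "norm x \<le> norm z + norm (z - x)" "norm z \<le> norm x + norm (z - x)"
      by norm+
    then have "x \<notin> ball 0 R" "z \<notin> ball 0 R" using False that by auto
    then have "G x = 0" "G z = 0" using R G(2) by blast+
    then show ?thesis using \<omega> by simp
  qed
  define h0 where "h0 = min \<delta> 1 / (norm d + 1)"
  show ?thesis
  proof (rule that[of h0])
    show "h0 > 0" using \<delta>(1) by (simp add: h0_def add_nonneg_pos)
    fix h x assume h: "0 < h" "h < h0"
    have "\<exists>t. 0 < t \<and> t < h \<and> y (x + h *\<^sub>R d) - y (x + 0 *\<^sub>R d) = (h - 0) * (G (x + t *\<^sub>R d) \<bullet> d)"
    proof (rule MVT2[OF h(1)])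
      fix t
      have "((\<lambda>t. y (x + t *\<^sub>R d)) has_derivative (\<lambda>s. G (x + t *\<^sub>R d) \<bullet> (s *\<^sub>R d))) (at t)"
        by (rule has_derivative_compose[OF _ y]) (auto intro!: derivative_eq_intros)
      moreover have "(\<lambda>s. G (x + t *\<^sub>R d) \<bullet> (s *\<^sub>R d)) = (*) (G (x + t *\<^sub>R d) \<bullet> d)" by auto
      ultimately show "((\<lambda>t. y (x + t *\<^sub>R d)) has_real_derivative G (x + t *\<^sub>R d) \<bullet> d) (at t)"
        by (simp add: has_field_derivative_def)
    qed
    then obtain t where t: "0 < t" "t < h" "y (x + h *\<^sub>R d) - y x = h * (G (x + t *\<^sub>R d) \<bullet> d)" by auto
    have "t * norm d \<le> h * (norm d + 1)" using t h by (intro mult_mono) auto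
    also have "\<dots> < min \<delta> 1" using h(2) unfolding h0_def by (simp add: pos_less_divide_eq add_nonneg_pos del: min_less_iff_conj)
    finally have "norm (G (x + t *\<^sub>R d) - G x) \<le> \<omega> / (norm d + 1)" using t by (intro unif) simp
    then have "norm (G (x + t *\<^sub>R d) - G x) * norm d \<le> \<omega> / (norm d + 1) * (norm d + 1)"
      using \<omega> by (intro mult_mono) (auto simp: add_nonneg_pos)
    also have "\<dots> = \<omega>" by (simp add: add_nonneg_eq_0_iff)
    finally have "\<bar>(G (x + t *\<^sub>R d) - G x) \<bullet> d\<bar> \<le> \<omega>"
      using Cauchy_Schwarz_ineq2 order_trans by blast
    then show "\<bar>(y (x + h *\<^sub>R d) - y x) / h - G x \<bullet> d\<bar> \<le> \<omega>"
      using t h by (simp add: inner_diff_left)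
  qed
qed

text \<open>Holds for every \<open>f\<close>: without measurability neither side is integrable, and
  both integrals take the default value 0.\<close>

lemma lborel_integral_translate:
  fixes f :: "'a::euclidean_space \<Rightarrow> real"
  shows "(LINT x|lborel. f (x + t)) = (LINT x|lborel. f x)"
proof -
  have "(LINT x|lborel. f x) = (LINT x|distr lborel borel ((+) t). f x)" by (simp add: lborel_distr_plus)
  also have "\<dots> = (LINT x|lborel. f (t + x))"
  proof (cases "f \<in> borel_measurable borel")
    case True
    then show ?thesis by (intro integral_distr) auto
  next
    case False
    have "\<not> integrable lborel f" using False by auto
    moreover have "(\<lambda>x. f (t + x)) \<notin> borel_measurable borel"
    proof
      assume "(\<lambda>x. f (t + x)) \<in> borel_measurable borel"
      then have "(\<lambda>x. f (t + (x - t))) \<in> borel_measurable borel" by measurable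
      then show False using False by simp
    qed
    then have "\<not> integrable lborel (\<lambda>x. f (t + x))" by auto
    ultimately show ?thesis by (simp add: lborel_distr_plus not_integrable_integral_eq)
  qed
  finally show ?thesis by (simp add: add.commute)
qed

text \<open>By translation invariance every difference quotient has integral zero, and the quotients
  converge to the derivative uniformly and inside a fixed ball.\<close>

lemma integral_directional_derivative_zero:
  fixes y :: "'a::euclidean_space \<Rightarrow> real"
  assumes y: "\<And>x. (y has_derivative (\<lambda>h. G x \<bullet> h)) (at x)" "\<And>x. x \<notin> K \<Longrightarrow> y x = 0"
    and G: "continuous_on UNIV G" "\<And>x. x \<notin> K \<Longrightarrow> G x = 0" "compact K"
  shows "integrable lborel (\<lambda>x. G x \<bullet> d)" "(LINT x|lborel. G x \<bullet> d) = 0"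
proof -
  obtain R where R: "K \<subseteq> ball 0 R"
    using bounded_subset_ballD[OF compact_imp_bounded[OF G(3)], of 0] by blast
  have int: "integrable lborel f" if f: "continuous_on UNIV f" "\<And>x. x \<notin> K \<Longrightarrow> f x = 0" for f :: "'a \<Rightarrow> real"
  proof -
    have "integrable lborel (\<lambda>x. indicator K x *\<^sub>R f x)"
      using f G(3) by (intro borel_integrable_compact) (auto intro: continuous_on_subset)
    moreover have "(\<lambda>x. indicator K x *\<^sub>R f x) = f"
    proof
      show "indicator K x *\<^sub>R f x = f x" for x using f(2)[of x] by (cases "x \<in> K") auto
    qed
    ultimately show ?thesis by (simp only:)
  qed
  show intG: "integrable lborel (\<lambda>x. G x \<bullet> d)"
    by (rule int) (use G in \<open>auto intro!: continuous_intros\<close>)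
  have "continuous_on UNIV y"
    using y(1) by (meson continuous_at_imp_continuous_on has_derivative_continuous)
  then have inty: "integrable lborel y" by (rule int) (use y in auto)
  have intyt: "integrable lborel (\<lambda>x. y (x + t))" for t
  proof -
    have "integrable (distr lborel borel ((+) t)) y" using inty by (simp add: lborel_distr_plus)
    then show ?thesis by (subst (asm) integrable_distr_eq) (use borel_measurable_integrable[OF inty] in \<open>auto simp: add.commute\<close>)
  qed
  \<comment> \<open>The radius leaves room for shifts \<open>h *\<^sub>R d\<close> with
    \<open>h \<le> 1\<close>, so all difference quotients vanish outside \<open>B\<close>.\<close>
  define B where "B = cball (0::'a) (R + norm d)"
  have intB: "integrable lborel (indicator B :: 'a \<Rightarrow> real)"
    unfolding B_def by (intro integrable_real_indicator emeasure_lborel_cball_finite) simp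
  have bnd: "\<bar>LINT x|lborel. G x \<bullet> d\<bar> \<le> \<omega> * measure lborel B" if \<omega>: "\<omega> > 0" for \<omega>
  proof -
    obtain h0 where h0: "h0 > 0" "\<And>h x. 0 < h \<Longrightarrow> h < h0 \<Longrightarrow> \<bar>(y (x + h *\<^sub>R d) - y x) / h - G x \<bullet> d\<bar> \<le> \<omega>"
      using uniform_difference_quotient[OF y(1) G \<omega>] by blast
    define h where "h = min (h0 / 2) 1"
    have h: "0 < h" "h < h0" "h \<le> 1" using h0(1) by (auto simp: h_def)
    let ?q = "\<lambda>x. (y (x + h *\<^sub>R d) - y x) / h"
    have intq: "integrable lborel ?q"
      by (intro integrable_divide Bochner_Integration.integrable_diff intyt inty)
    have "(LINT x|lborel. ?q x) = 0"
      by (simp add: intyt inty lborel_integral_translate)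
    then have "(LINT x|lborel. G x \<bullet> d) = - (LINT x|lborel. ?q x - G x \<bullet> d)"
      using intG intq by (subst Bochner_Integration.integral_diff) simp_all
    then have "\<bar>LINT x|lborel. G x \<bullet> d\<bar> \<le> (LINT x|lborel. \<bar>?q x - G x \<bullet> d\<bar>)"
      by simp
    also have "\<dots> \<le> (LINT x|lborel. \<omega> * indicator B x)"
    proof (rule integral_mono)
      show "integrable lborel (\<lambda>x. \<bar>?q x - G x \<bullet> d\<bar>)"
        by (intro integrable_abs Bochner_Integration.integrable_diff intq intG)
      show "integrable lborel (\<lambda>x. \<omega> * indicator B x)" using intB by simp
      fix x
      show "\<bar>?q x - G x \<bullet> d\<bar> \<le> \<omega> * indicator B x"
      proof (cases "x \<in> B")
        case True
        then show ?thesis using h0(2)[OF h(1,2)] by simp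
      next
        case False
        have "norm (h *\<^sub>R d) \<le> norm d" using h mult_right_mono[of h 1 "norm d"] by simp
        moreover have "norm x \<le> norm (x + h *\<^sub>R d) + norm (h *\<^sub>R d)"
          using norm_triangle_sub[of x "x + h *\<^sub>R d"] by simp
        ultimately have "R < norm (x + h *\<^sub>R d)" "R < norm x"
          using False norm_ge_zero[of d] unfolding B_def by (auto simp del: norm_ge_zero)
        then have "x \<notin> K" "x + h *\<^sub>R d \<notin> K" using R by auto
        then show ?thesis using False y(2) G(2) by simp
      qed
    qed
    also have "\<dots> = \<omega> * measure lborel B" by simp
    finally show ?thesis .
  qed
  have "\<bar>LINT x|lborel. G x \<bullet> d\<bar> \<le> 0"
  proof (rule field_le_epsilon)
    fix e :: real assume e: "e > 0"
    define m where "m = measure lborel B"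
    have m: "0 \<le> m" by (simp add: m_def)
    then have "0 < e / (m + 1)" using e by simp
    from bnd[OF this] have "\<bar>LINT x|lborel. G x \<bullet> d\<bar> \<le> e * (m / (m + 1))" by (simp add: m_def)
    also have "\<dots> \<le> e * 1" using e m by (intro mult_left_mono) auto
    finally show "\<bar>LINT x|lborel. G x \<bullet> d\<bar> \<le> 0 + e" by simp
  qed
  then show "(LINT x|lborel. G x \<bullet> d) = 0" by simp
qed

lemma inner_matrix_rows: "(A :: real^'n^'m) \<bullet> B = (\<Sum>i\<in>UNIV. A $ i \<bullet> B $ i)"
  by (simp add: inner_vec_def)

lemma test_function_integral_jacobian:
  fixes \<phi> :: "real^'n \<Rightarrow> real^'m" and L :: "real^'n^'m"
  assumes tf: "\<phi> \<in> test_functions unit_cube"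
  shows "(LINT x:unit_cube|lborel. L \<bullet> jacobian \<phi> (at x)) = 0"
proof -
  let ?K = "closure {x. \<phi> x \<noteq> 0}"
  have row: "axis i 1 v* jacobian \<phi> (at x) = jacobian \<phi> (at x) $ i" for i :: 'm and x
    by (simp add: vec_eq_iff vector_matrix_mult_def axis_def if_distrib[of "\<lambda>x. x * _"] cong: if_cong)
  have *: "integrable lborel (\<lambda>x. jacobian \<phi> (at x) $ i \<bullet> d)" "(LINT x|lborel. jacobian \<phi> (at x) $ i \<bullet> d) = 0" for i d
  proof -
    have 1: "((\<lambda>x. axis i 1 \<bullet> \<phi> x) has_derivative (\<lambda>h. jacobian \<phi> (at x) $ i \<bullet> h)) (at x)" for x
      using test_function_component_derivative[OF tf, of "axis i 1" x] by (simp only: row)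
    have 2: "continuous_on UNIV (\<lambda>x. jacobian \<phi> (at x) $ i)"
      by (rule continuous_on_component[OF test_function_jacobian_continuous[OF tf]])
    have 3: "axis i 1 \<bullet> \<phi> x = 0" "jacobian \<phi> (at x) $ i = 0" if "x \<notin> ?K" for x
      using test_function_zero[OF tf that] test_function_jacobian_zero[OF tf that] by simp_all
    note * = integral_directional_derivative_zero[OF 1 3(1) 2 3(2) test_function_compact(1)[OF tf]]
    show "integrable lborel (\<lambda>x. jacobian \<phi> (at x) $ i \<bullet> d)" by (rule *(1))
    show "(LINT x|lborel. jacobian \<phi> (at x) $ i \<bullet> d) = 0" by (rule *(2))
  qed
  have "indicator unit_cube x *\<^sub>R (L \<bullet> jacobian \<phi> (at x)) = (\<Sum>i\<in>UNIV. jacobian \<phi> (at x) $ i \<bullet> L $ i)" for x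
  proof (cases "x \<in> unit_cube")
    case True
    then show ?thesis by (simp add: inner_matrix_rows inner_commute)
  next
    case False
    then have "jacobian \<phi> (at x) = 0"
      using test_function_compact(2)[OF tf] by (intro test_function_jacobian_zero[OF tf]) blast
    then show ?thesis by simp
  qed
  then show ?thesis unfolding set_lebesgue_integral_def using * by (simp add: Bochner_Integration.integral_sum)
qed

section \<open>Energies and bounds for the quasiconvex envelope\<close>

lemma continuous_on_h_simp: "continuous_on A (h_simp l)"
  unfolding h_simp_def by (intro continuous_intros)

lemma test_function_continuous_compose:
  assumes "\<phi> \<in> test_functions U" "continuous_on UNIV f"
  shows "continuous_on UNIV (\<lambda>x. f (jacobian \<phi> (at x)))"
  using continuous_on_compose2[OF assms(2) test_function_jacobian_continuous[OF assms(1)]] by simp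

text \<open>A linear function of the gradient has mean zero, so it can be subtracted for free. Every
  later estimate is pointwise, for the excess over an affine function, and is transferred to
  energies here.\<close>

lemma energy_excess:
  fixes \<phi> :: "real^'n \<Rightarrow> real^'m" and \<xi> :: "real^'n^'m"
  assumes tf: "\<phi> \<in> test_functions unit_cube"
  shows "(LINT x:unit_cube|lborel. h_simp l (\<xi> + jacobian \<phi> (at x)) - c - L \<bullet> jacobian \<phi> (at x)) =
         (LINT x:unit_cube|lborel. h_simp l (\<xi> + jacobian \<phi> (at x))) - c"
proof -
  have 1: "set_integrable lborel unit_cube (\<lambda>x. h_simp l (\<xi> + jacobian \<phi> (at x)))"
    by (intro set_integrable_unit_cube test_function_continuous_compose[OF tf]
        continuous_on_compose2[OF continuous_on_h_simp[of UNIV]] continuous_intros) auto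
  have 2: "set_integrable lborel unit_cube (\<lambda>x. L \<bullet> jacobian \<phi> (at x))"
    by (intro set_integrable_unit_cube test_function_continuous_compose[OF tf] continuous_intros)
  have 3: "set_integrable lborel unit_cube (\<lambda>x::real^'n. c)"
    by (intro set_integrable_unit_cube continuous_intros)
  show ?thesis
    using 1 2 3 test_function_integral_jacobian[OF tf, of L] by simp
qed

lemma energy_ge_huber:
  fixes \<phi> :: "real^'n \<Rightarrow> real^'m" and \<xi> :: "real^'n^'m"
  assumes l: "l > 0" and tf: "\<phi> \<in> test_functions unit_cube"
  shows "huber l \<xi> \<le> (LINT x:unit_cube|lborel. h_simp l (\<xi> + jacobian \<phi> (at x)))"
proof -
  have "0 \<le> h_simp l (\<xi> + jacobian \<phi> (at x)) - huber l \<xi> - huber_slope l \<xi> \<bullet> jacobian \<phi> (at x)" for x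
    using huber_subgradient[OF l, of \<xi> "\<xi> + jacobian \<phi> (at x)"] huber_le_h_simp[OF l, of "\<xi> + jacobian \<phi> (at x)"]
    by simp
  then have "0 \<le> (LINT x:unit_cube|lborel. h_simp l (\<xi> + jacobian \<phi> (at x)) - huber l \<xi> - huber_slope l \<xi> \<bullet> jacobian \<phi> (at x))"
    unfolding set_lebesgue_integral_def by (intro Bochner_Integration.integral_nonneg) auto
  then show ?thesis unfolding energy_excess[OF tf] by simp
qed

lemma C_order_const: "C_order k (\<lambda>_::real^'n. c::'b::real_normed_vector)"
proof (induction k arbitrary: c)
  case (Suc k)
  have "frechet_derivative (\<lambda>_::real^'n. c) (at x) = (\<lambda>_. 0)" for x
    by (rule frechet_derivative_at[symmetric]) simp
  then show ?case using Suc by simp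
qed simp

lemma zero_test_function: "(\<lambda>_. 0) \<in> test_functions U"
  by (simp add: test_functions_def smooth_def C_order_const)

lemma quasiconvex_envelope_ge:
  fixes \<xi> :: "real^'n^'m"
  assumes "\<And>\<phi>. \<phi> \<in> test_functions unit_cube \<Longrightarrow> c \<le> (LINT x:unit_cube|lborel. h_simp l (\<xi> + jacobian \<phi> (at x)))"
  shows "c \<le> quasiconvex_envelope (h_simp l) \<xi>"
  unfolding quasiconvex_envelope_def
  by (rule cINF_greatest) (use zero_test_function assms in blast)+

text \<open>A real infimum lies below its members only when the set is bounded below;
  \<open>energy_ge_huber\<close> supplies the bound.\<close>

lemma quasiconvex_envelope_le:
  fixes \<xi> :: "real^'n^'m"
  assumes "l > 0" "\<phi> \<in> test_functions unit_cube"
  shows "quasiconvex_envelope (h_simp l) \<xi> \<le> (LINT x:unit_cube|lborel. h_simp l (\<xi> + jacobian \<phi> (at x)))"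
  unfolding quasiconvex_envelope_def
  by (rule cINF_lower[OF _ assms(2)]) (rule bdd_belowI2[of _ "huber l \<xi>"], rule energy_ge_huber[OF assms(1)])

lemma quasiconvex_envelope_le_h_simp:
  fixes \<xi> :: "real^'n^'m"
  assumes "l > 0"
  shows "quasiconvex_envelope (h_simp l) \<xi> \<le> h_simp l \<xi>"
proof -
  have "jacobian (\<lambda>_::real^'n. 0::real^'m) (at x) = 0" for x
    by (rule test_function_jacobian_zero[OF zero_test_function]) simp
  then show ?thesis using quasiconvex_envelope_le[OF assms zero_test_function, of \<xi>] by simp
qed

subsection \<open>The strict inequality for matrices of rank at least two\<close>

text \<open>The dual basis of two independent columns \<open>p\<close>, \<open>q\<close> within
  their span, obtained by inverting the Gram matrix with determinant \<Delta>.\<close>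

lemma rank_ge_2_dual_columns:
  fixes X :: "real^'n^'m"
  assumes "rank X \<ge> 2"
  obtains j1 j2 \<alpha> \<beta> where "\<alpha> \<bullet> column j1 X = 1" "\<alpha> \<bullet> column j2 X = 0" "\<beta> \<bullet> column j1 X = 0" "\<beta> \<bullet> column j2 X = 1"
proof -
  have dim: "dim (columns X) \<ge> 2" using assms by (simp add: column_rank_def)
  have ex: "\<exists>j. column j X \<notin> span {p}" for p
  proof (rule ccontr)
    assume "\<nexists>j. column j X \<notin> span {p}"
    then have "columns X \<subseteq> span {p}" by (auto simp: columns_def)
    then have "dim (columns X) \<le> card {p}" by (rule dim_le_card) simp
    then show False using dim by simp
  qed
  obtain j1 where j1: "column j1 X \<notin> span {0}" using ex by blast
  define p where "p = column j1 X"
  obtain j2 where j2: "column j2 X \<notin> span {p}" using ex by blast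
  define q where "q = column j2 X"
  have p0: "p \<bullet> p \<noteq> 0" using j1 by (auto simp: p_def)
  define \<Delta> where "\<Delta> = (p \<bullet> p) * (q \<bullet> q) - (p \<bullet> q)\<^sup>2"
  have "\<Delta> \<noteq> 0"
  proof
    assume \<Delta>: "\<Delta> = 0"
    \<comment> \<open>Up to the factor \<open>p \<bullet> p\<close> this is the part of
      \<open>q\<close> orthogonal to \<open>p\<close>, so a vanishing \<Delta> would put
      \<open>q\<close> on the line of \<open>p\<close>.\<close>
    define w where "w = (p \<bullet> p) *\<^sub>R q - (p \<bullet> q) *\<^sub>R p"
    have "w \<bullet> w = (p \<bullet> p) * \<Delta>"
      by (simp add: w_def \<Delta>_def inner_diff_left inner_diff_right inner_commute[of q p] power2_eq_square algebra_simps)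
    then have "w = 0" using \<Delta> by simp
    then have "(p \<bullet> p) *\<^sub>R q = (p \<bullet> q) *\<^sub>R p" by (simp add: w_def)
    then have "(1 / (p \<bullet> p)) *\<^sub>R ((p \<bullet> p) *\<^sub>R q) = (1 / (p \<bullet> p)) *\<^sub>R ((p \<bullet> q) *\<^sub>R p)" by simp
    then have "q = ((p \<bullet> q) / (p \<bullet> p)) *\<^sub>R p" using p0 by simp
    then have "q \<in> span {p}" by (metis span_base span_mul singletonI)
    then show False using j2 by (simp add: q_def)
  qed
  have *: "(q \<bullet> q) * (p \<bullet> p) - (p \<bullet> q) * (p \<bullet> q) = \<Delta>" "(p \<bullet> p) * (q \<bullet> q) - (p \<bullet> q) * (p \<bullet> q) = \<Delta>"
    by (simp_all add: \<Delta>_def power2_eq_square mult.commute)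
  show ?thesis
  proof (rule that)
    show "((1 / \<Delta>) *\<^sub>R ((q \<bullet> q) *\<^sub>R p - (p \<bullet> q) *\<^sub>R q)) \<bullet> column j1 X = 1"
      "((1 / \<Delta>) *\<^sub>R ((q \<bullet> q) *\<^sub>R p - (p \<bullet> q) *\<^sub>R q)) \<bullet> column j2 X = 0"
      "((1 / \<Delta>) *\<^sub>R ((p \<bullet> p) *\<^sub>R q - (p \<bullet> q) *\<^sub>R p)) \<bullet> column j1 X = 0"
      "((1 / \<Delta>) *\<^sub>R ((p \<bullet> p) *\<^sub>R q - (p \<bullet> q) *\<^sub>R p)) \<bullet> column j2 X = 1"
      using \<open>\<Delta> \<noteq> 0\<close> unfolding p_def[symmetric] q_def[symmetric]
      by (simp_all add: inner_diff_left inner_commute[of q p] *)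
  qed
qed

section \<open>From lattice squares to integrals over the unit cube\<close>

definition lattice_vec :: "'n \<Rightarrow> 'n \<Rightarrow> int \<Rightarrow> int \<times> int \<Rightarrow> real^'n" where
  "lattice_vec j1 j2 M a = (of_int (fst a) / of_int M) *\<^sub>R axis j1 1 + (of_int (snd a) / of_int M) *\<^sub>R axis j2 1"

lemma lattice_vec_nth:
  "lattice_vec j1 j2 M a $ j = (if j = j1 then real_of_int (fst a) / M else 0) + (if j = j2 then real_of_int (snd a) / M else 0)"
  by (simp add: lattice_vec_def axis_def)

text \<open>The lattice translates of the slab \<open>K\<close>, with side \<open>1 / M\<close> in
  the directions \<open>j1\<close>, \<open>j2\<close> and side 1 in the others, are disjoint subsets
  of the cube. So the integral of \<open>Y\<close> is at least the integral over \<open>K\<close> of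
  the lattice sums, and \<open>K\<close> has volume \<open>1 / M^2\<close>.\<close>

lemma tiling_bound:
  fixes Y :: "real^'n \<Rightarrow> real"
  assumes Y: "continuous_on UNIV Y" "\<And>x. 0 \<le> Y x" and j: "j1 \<noteq> j2" and M: "M \<ge> 1"
    and B: "\<And>y. y \<in> unit_cube \<Longrightarrow> y $ j1 < 1 / M \<Longrightarrow> y $ j2 < 1 / M \<Longrightarrow>
        B \<le> (\<Sum>a\<in>{0..<M}\<times>{0..<M}. Y (y + lattice_vec j1 j2 M a))"
  shows "B / (real_of_int M)\<^sup>2 \<le> (LINT x:unit_cube|lborel. Y x)"
proof -
  let ?Q = "{0..<M}\<times>{0..<M}" and ?v = "lattice_vec j1 j2 M"
  define b :: "real^'n" where "b = (\<chi> j. if j = j1 \<or> j = j2 then 1 / M else 1)"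
  define K where "K = box 0 b"
  have ble: "b $ j \<le> 1" for j using M by (auto simp: b_def)
  have K: "y \<in> K \<longleftrightarrow> (\<forall>j. 0 < y $ j \<and> y $ j < b $ j)" for y by (simp add: K_def mem_box_cart)
  have Kc: "K \<subseteq> unit_cube" unfolding unit_cube_def using K ble less_le_trans by blast
  have "measure lborel K = (\<Prod>j\<in>UNIV. b $ j)"
    unfolding K_def using M by (subst measure_lborel_box)
      (auto simp: b_def Basis_vec_def inner_axis prod.UNION_disjoint axis_eq_axis)
  also have "\<dots> = (\<Prod>j\<in>{j1, j2}. b $ j)"
    by (rule prod.mono_neutral_right) (auto simp: b_def)
  also have "\<dots> = 1 / (real_of_int M)\<^sup>2" using j by (simp add: b_def power2_eq_square)
  finally have mK: "measure lborel K = 1 / (real_of_int M)\<^sup>2" .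
  have intK: "integrable lborel (\<lambda>x. indicator K x * Y (x + t))" for t
  proof -
    have "continuous_on UNIV (\<lambda>x. Y (x + t))"
      by (rule continuous_on_compose2[OF Y(1)]) (auto intro!: continuous_intros)
    then have "set_integrable lborel K (\<lambda>x. Y (x + t))"
      using set_integrable_subset[OF set_integrable_unit_cube _ Kc] by (auto simp: K_def)
    then show ?thesis by (simp add: set_integrable_def)
  qed
  have "B / (real_of_int M)\<^sup>2 = (LINT x|lborel. indicator K x * B)" using mK by simp
  also have "\<dots> \<le> (LINT x|lborel. (\<Sum>a\<in>?Q. indicator K x * Y (x + ?v a)))"
  proof (rule integral_mono)
    show "integrable lborel (\<lambda>x. indicator K x * B)"
      unfolding K_def by (intro integrable_mult_left integrable_real_indicator emeasure_bounded_finite bounded_box) simp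
    show "integrable lborel (\<lambda>x. \<Sum>a\<in>?Q. indicator K x * Y (x + ?v a))"
      by (intro Bochner_Integration.integrable_sum intK)
    fix x
    show "indicator K x * B \<le> (\<Sum>a\<in>?Q. indicator K x * Y (x + ?v a))"
    proof (cases "x \<in> K")
      case True
      then have "x $ j1 < b $ j1" "x $ j2 < b $ j2" by (simp_all add: K)
      then have "B \<le> (\<Sum>a\<in>?Q. Y (x + ?v a))" using True Kc by (intro B) (auto simp: b_def)
      then show ?thesis using True by simp
    qed simp
  qed
  also have "\<dots> = (\<Sum>a\<in>?Q. LINT x|lborel. indicator K x * Y (x + ?v a))"
    by (rule Bochner_Integration.integral_sum[OF intK])
  also have "\<dots> = (\<Sum>a\<in>?Q. LINT x|lborel. indicator K (x - ?v a) * Y x)"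
  proof (rule sum.cong[OF refl])
    fix a
    show "(LINT x|lborel. indicator K x * Y (x + ?v a)) = (LINT x|lborel. indicator K (x - ?v a) * Y x)"
      using lborel_integral_translate[of "\<lambda>x. indicator K (x - ?v a) * Y x" "?v a"] by simp
  qed
  also have "\<dots> = (LINT x|lborel. (\<Sum>a\<in>?Q. indicator K (x - ?v a) * Y x))"
  proof (rule Bochner_Integration.integral_sum[symmetric])
    fix a
    have "integrable (distr lborel borel ((+) (- ?v a))) (\<lambda>x. indicator K x * Y (x + ?v a))"
      using intK by (simp add: lborel_distr_plus)
    then show "integrable lborel (\<lambda>x. indicator K (x - ?v a) * Y x)"
      by (subst (asm) integrable_distr_eq) (use borel_measurable_integrable[OF intK[of "?v a"]] in \<open>auto simp: algebra_simps\<close>)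
  qed
  also have "\<dots> \<le> (LINT x|lborel. indicator unit_cube x * Y x)"
  proof (rule integral_mono_AE')
    show "integrable lborel (\<lambda>x. indicator unit_cube x * Y x)"
      using set_integrable_unit_cube[OF Y(1)] by (simp add: set_integrable_def)
    show "AE x in lborel. 0 \<le> indicator unit_cube x * Y x"
      using Y(2) by (intro AE_I2 mult_nonneg_nonneg) auto
    show "AE x in lborel. (\<Sum>a\<in>?Q. indicator K (x - ?v a) * Y x) \<le> indicator unit_cube x * Y x"
    proof (rule AE_I2)
      fix x :: "real^'n"
      \<comment> \<open>The only lattice point whose translate of \<open>K\<close> can contain
        \<open>x\<close>.\<close>
      define a0 where "a0 = (\<lfloor>M * x $ j1\<rfloor>, \<lfloor>M * x $ j2\<rfloor>)"
      have in_cube: "x \<in> unit_cube \<and> a = a0" if a: "a \<in> ?Q" "x - ?v a \<in> K" for a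
      proof -
        have 1: "0 < x $ j1 - real_of_int (fst a) / M" "x $ j1 - real_of_int (fst a) / M < 1 / M"
             "0 < x $ j2 - real_of_int (snd a) / M" "x $ j2 - real_of_int (snd a) / M < 1 / M"
          using a(2) j unfolding K by (auto simp: lattice_vec_nth b_def dest: spec[of _ j1] spec[of _ j2])
        have M0: "(0::real) < M" using M by simp
        have 2: "real_of_int (fst a) < M * x $ j1" "M * x $ j1 < real_of_int (fst a) + 1" "real_of_int (snd a) < M * x $ j2" "M * x $ j2 < real_of_int (snd a) + 1"
        proof -
          have "x $ j1 < (real_of_int (fst a) + 1) / M" "x $ j2 < (real_of_int (snd a) + 1) / M"
            using 1 by (simp_all add: add_divide_distrib)
          then show "M * x $ j1 < real_of_int (fst a) + 1" "M * x $ j2 < real_of_int (snd a) + 1"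
            using M0 by (simp_all add: pos_less_divide_eq mult.commute)
          have "real_of_int (fst a) / M < x $ j1" "real_of_int (snd a) / M < x $ j2" using 1 by simp_all
          then show "real_of_int (fst a) < M * x $ j1" "real_of_int (snd a) < M * x $ j2"
            using M0 by (simp_all add: pos_divide_less_eq mult.commute)
        qed
        then have "a = a0" unfolding a0_def by (intro prod_eqI) (simp_all add: floor_eq_iff eq_commute[of "fst a"] eq_commute[of "snd a"])
        moreover have "0 < x $ i \<and> x $ i < 1" for i
        proof (cases "i = j1 \<or> i = j2")
          case True
          have "real_of_int (fst a) + 1 \<le> M" "real_of_int (snd a) + 1 \<le> M" "0 \<le> fst a" "0 \<le> snd a"
            using a(1) by auto
          then have "0 < M * x $ j1" "M * x $ j1 < M * 1" "0 < M * x $ j2" "M * x $ j2 < M * 1"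
            using 2 by linarith+
          then show ?thesis using True M0 by (auto simp: zero_less_mult_iff)
        next
          case False
          then show ?thesis using a(2) unfolding K by (auto simp: lattice_vec_nth b_def dest: spec[of _ i])
        qed
        ultimately show ?thesis by (simp add: unit_cube_def)
      qed
      have "(\<Sum>a\<in>?Q. indicator K (x - ?v a) * Y x) \<le> (\<Sum>a\<in>?Q. if a = a0 then indicator unit_cube x * Y x else 0)"
        by (rule sum_mono) (use in_cube Y(2) in \<open>auto simp: indicator_def\<close>)
      also have "\<dots> \<le> indicator unit_cube x * Y x" using Y(2) by (simp add: sum.delta)
      finally show "(\<Sum>a\<in>?Q. indicator K (x - ?v a) * Y x) \<le> indicator unit_cube x * Y x" .
    qed
  qed
  finally show ?thesis by (simp add: set_lebesgue_integral_def)
qed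

lemma compact_subset_unit_cube_margin:
  fixes K :: "(real^'n) set"
  assumes "compact K" "K \<subseteq> unit_cube"
  obtains \<delta> where "\<delta> > 0" "\<And>x j. x \<in> K \<Longrightarrow> \<delta> \<le> x $ j \<and> x $ j \<le> 1 - \<delta>"
proof -
  have "open (unit_cube :: (real^'n) set)" unfolding unit_cube_eq_box by (rule open_box)
  then obtain e where e: "e > 0" "(\<Union>x\<in>K. ball x e) \<subseteq> unit_cube"
    using compact_subset_open_imp_ball_epsilon_subset[OF assms(1) _ assms(2)] by blast
  have "e / 2 \<le> x $ j \<and> x $ j \<le> 1 - e / 2" if x: "x \<in> K" for x j
  proof -
    have "x + (e / 2) *\<^sub>R axis j 1 \<in> ball x e" "x - (e / 2) *\<^sub>R axis j 1 \<in> ball x e"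
      using e(1) by (auto simp: dist_norm)
    then have "x + (e / 2) *\<^sub>R axis j 1 \<in> unit_cube" "x - (e / 2) *\<^sub>R axis j 1 \<in> unit_cube"
      using e(2) x by blast+
    then have "(x + (e / 2) *\<^sub>R axis j 1) $ j < 1" "0 < (x - (e / 2) *\<^sub>R axis j 1) $ j"
      unfolding unit_cube_def by blast+
    then show ?thesis by simp
  qed
  then show ?thesis using that[of "e / 2"] e(1) by simp
qed

lemma matrix_bilinear_bound:
  "\<exists>C\<ge>0. \<forall>P::real^'n^'m. \<bar>\<alpha> \<bullet> (P *v d)\<bar> \<le> C * norm P"
proof (intro exI[of _ "norm (\<chi> i j. \<alpha> $ i * d $ j :: real^'n^'m)"] conjI allI)
  show "\<bar>\<alpha> \<bullet> (P *v d)\<bar> \<le> norm (\<chi> i j. \<alpha> $ i * d $ j :: real^'n^'m) * norm P" for P :: "real^'n^'m"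
  proof -
    have "\<alpha> \<bullet> (P *v d) = (\<chi> i j. \<alpha> $ i * d $ j) \<bullet> P"
      by (simp add: inner_vec_def matrix_vector_mult_def sum_distrib_left mult_ac)
    then show ?thesis using Cauchy_Schwarz_ineq2 by metis
  qed
qed simp

text \<open>For a unit matrix \<open>X\<close> the first term is the part of \<open>J\<close>
  orthogonal to \<open>X\<close>. The other two ask \<open>c + X \<bullet> J\<close> to be
  nonnegative and near zero; truncation at 1 makes large values count only through the measure of
  the set where they occur, so concentration is not penalized.\<close>

definition deviation :: "real \<Rightarrow> 'a::real_inner \<Rightarrow> 'a \<Rightarrow> real" where
  "deviation c X J = norm (J - (X \<bullet> J) *\<^sub>R X) + max 0 (- (c + X \<bullet> J)) + min (max 0 (c + X \<bullet> J)) 1"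

lemma deviation_nonneg: "0 \<le> deviation c X J"
  by (simp add: deviation_def)

text \<open>Freeze a base point \<open>z\<close> in the small slab and read \<phi> on the lattice
  through \<open>z\<close>: the components along \<alpha> and \<beta> play the roles of
  \<open>y\<close> and \<open>y'\<close> in \<open>lattice_concentration_bound\<close>. Averaging
  over \<open>z\<close> is \<open>tiling_bound\<close>.\<close>

lemma gradient_lattice_bound:
  fixes \<phi> :: "real^'n \<Rightarrow> real^'m" and X :: "real^'n^'m"
  assumes c: "c > 0" and tf: "\<phi> \<in> test_functions unit_cube"
    and d1: "d1 = axis j1 1 + axis j2 1" and d2: "d2 = axis j1 1 - axis j2 1"
    and \<alpha>: "\<alpha> \<bullet> (X *v d1) = 0" "\<alpha> \<bullet> (X *v d2) = 1"
    and \<beta>: "\<beta> \<bullet> (X *v d1) = 1" "\<beta> \<bullet> (X *v d2) = 0"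
    and j: "j1 \<noteq> j2"
    and C: "C \<ge> 1"
      "\<And>P. \<bar>\<alpha> \<bullet> (P *v d1)\<bar> \<le> C * norm P" "\<And>P. \<bar>\<alpha> \<bullet> (P *v d2)\<bar> \<le> C * norm P"
      "\<And>P. \<bar>\<beta> \<bullet> (P *v d1)\<bar> \<le> C * norm P" "\<And>P. \<bar>\<beta> \<bullet> (P *v d2)\<bar> \<le> C * norm P"
  shows "min (1/800) (c/10) / (2 * C) \<le> (LINT x:unit_cube|lborel. deviation c X (jacobian \<phi> (at x)))"
proof -
  define Y where "Y x = deviation c X (jacobian \<phi> (at x))" for x
  let ?K = "closure {x. \<phi> x \<noteq> 0}"
  define \<epsilon> where "\<epsilon> = min (1/800) (c/10)"
  have \<epsilon>: "\<epsilon> > 0" using c by (simp add: \<epsilon>_def)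
  have quot: "\<exists>h0>0. \<forall>h x. 0 < h \<longrightarrow> h < h0 \<longrightarrow> \<bar>(a \<bullet> \<phi> (x + h *\<^sub>R d) - a \<bullet> \<phi> x) / h - a \<bullet> (jacobian \<phi> (at x) *v d)\<bar> \<le> \<epsilon> / 2" for a d
  proof -
    have 1: "continuous_on UNIV (\<lambda>x. a v* jacobian \<phi> (at x))"
      unfolding vector_matrix_mult_def
      by (intro continuous_on_vec_lambda continuous_intros continuous_on_component test_function_jacobian_continuous[OF tf])
    have 2: "a v* jacobian \<phi> (at x) = 0" if "x \<notin> ?K" for x
      using test_function_jacobian_zero[OF tf that] by (simp add: vector_matrix_mult_def vec_eq_iff)
    obtain h0 where "h0 > 0" "\<And>h x. 0 < h \<Longrightarrow> h < h0 \<Longrightarrow>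
        \<bar>(a \<bullet> \<phi> (x + h *\<^sub>R d) - a \<bullet> \<phi> x) / h - (a v* jacobian \<phi> (at x)) \<bullet> d\<bar> \<le> \<epsilon> / 2"
      using uniform_difference_quotient[OF test_function_component_derivative[OF tf] 1 2 test_function_compact(1)[OF tf] half_gt_zero[OF \<epsilon>]]
      by blast
    then show ?thesis by (auto simp: dot_lmul_matrix)
  qed
  obtain h1 where h1: "h1 > 0" "\<And>h x. 0 < h \<Longrightarrow> h < h1 \<Longrightarrow> \<bar>(\<alpha> \<bullet> \<phi> (x + h *\<^sub>R d1) - \<alpha> \<bullet> \<phi> x) / h - \<alpha> \<bullet> (jacobian \<phi> (at x) *v d1)\<bar> \<le> \<epsilon> / 2"
    using quot by meson
  obtain h2 where h2: "h2 > 0" "\<And>h x. 0 < h \<Longrightarrow> h < h2 \<Longrightarrow> \<bar>(\<alpha> \<bullet> \<phi> (x + h *\<^sub>R d2) - \<alpha> \<bullet> \<phi> x) / h - \<alpha> \<bullet> (jacobian \<phi> (at x) *v d2)\<bar> \<le> \<epsilon> / 2"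
    using quot by meson
  obtain h3 where h3: "h3 > 0" "\<And>h x. 0 < h \<Longrightarrow> h < h3 \<Longrightarrow> \<bar>(\<beta> \<bullet> \<phi> (x + h *\<^sub>R d1) - \<beta> \<bullet> \<phi> x) / h - \<beta> \<bullet> (jacobian \<phi> (at x) *v d1)\<bar> \<le> \<epsilon> / 2"
    using quot by meson
  obtain h4 where h4: "h4 > 0" "\<And>h x. 0 < h \<Longrightarrow> h < h4 \<Longrightarrow> \<bar>(\<beta> \<bullet> \<phi> (x + h *\<^sub>R d2) - \<beta> \<bullet> \<phi> x) / h - \<beta> \<bullet> (jacobian \<phi> (at x) *v d2)\<bar> \<le> \<epsilon> / 2"
    using quot by meson
  obtain \<delta> where \<delta>: "\<delta> > 0" "\<And>x j. x \<in> ?K \<Longrightarrow> \<delta> \<le> x $ j \<and> x $ j \<le> 1 - \<delta>"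
    using compact_subset_unit_cube_margin[OF test_function_compact[OF tf]] by blast
  \<comment> \<open>Four thresholds for difference quotients of step \<open>1 / M\<close>; the fifth
    keeps the support more than \<open>3 / M\<close> away from the faces, which yields the margin
    required on the lattice.\<close>
  define \<eta> where "\<eta> = Min {h1, h2, h3, h4, \<delta> / 3}"
  have \<eta>: "\<eta> > 0" "\<eta> \<le> h1" "\<eta> \<le> h2" "\<eta> \<le> h3" "\<eta> \<le> h4" "\<eta> \<le> \<delta> / 3"
    using h1(1) h2(1) h3(1) h4(1) \<delta>(1) by (auto simp: \<eta>_def)
  define M where "M = max 40 (\<lceil>1 / \<eta>\<rceil> + 1)"
  have M: "M \<ge> 40" "1 / \<eta> < M" unfolding M_def by linarith+
  have M0: "0 < real_of_int M" using M by simp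
  have hM: "0 < 1 / real_of_int M" "1 / real_of_int M < \<eta>"
    using M M0 \<eta>(1) by (simp_all add: field_simps)
  have \<delta>M: "3 < real_of_int M * \<delta>"
  proof -
    have "1 / real_of_int M < \<delta> / 3" using hM \<eta>(6) by linarith
    then show ?thesis using M0 by (simp add: field_simps)
  qed
  let ?Q = "{0..<M}\<times>{0..<M}" and ?v = "lattice_vec j1 j2 M"
  have vd: "z + ?v (a + (1,1)) = z + ?v a + (1 / M) *\<^sub>R d1" "z + ?v (a + (1,-1)) = z + ?v a + (1 / M) *\<^sub>R d2" for z a
    by (simp_all add: lattice_vec_def d1 d2 add_divide_distrib diff_divide_distrib scaleR_add_left scaleR_add_right scaleR_diff_left scaleR_diff_right)
  have "\<epsilon> / (2 * C) * (real_of_int M)\<^sup>2 / (real_of_int M)\<^sup>2 \<le> (LINT x:unit_cube|lborel. Y x)"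
  proof (rule tiling_bound[OF _ _ j])
    show "continuous_on UNIV Y"
      unfolding Y_def deviation_def by (intro continuous_intros test_function_jacobian_continuous[OF tf])
    fix z :: "real^'n"
    assume z: "z \<in> unit_cube" "z $ j1 < 1 / M" "z $ j2 < 1 / M"
    have supp: "1 \<le> fst a \<and> fst a < M - 1 \<and> 1 \<le> snd a \<and> snd a < M - 1" if "b \<bullet> \<phi> (z + ?v a) \<noteq> 0" for a b
    proof -
      have "z + ?v a \<in> ?K"
      proof (rule ccontr)
        assume "z + ?v a \<notin> ?K"
        from test_function_zero[OF tf this] that show False by simp
      qed
      from \<delta>(2)[OF this, of j1] \<delta>(2)[OF this, of j2]
      have 1: "\<delta> \<le> z $ j1 + real_of_int (fst a) / M" "z $ j1 + real_of_int (fst a) / M \<le> 1 - \<delta>"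
           "\<delta> \<le> z $ j2 + real_of_int (snd a) / M" "z $ j2 + real_of_int (snd a) / M \<le> 1 - \<delta>"
        using j by (auto simp: lattice_vec_nth)
      have zb: "0 < z $ j1" "0 < z $ j2" using z(1) by (auto simp: unit_cube_def)
      have 2: "\<delta> < 1 / M + real_of_int (fst a) / M" "real_of_int (fst a) / M < 1 - \<delta>"
           "\<delta> < 1 / M + real_of_int (snd a) / M" "real_of_int (snd a) / M < 1 - \<delta>"
        using 1 zb z by linarith+
      have "M * \<delta> < 1 + real_of_int (fst a)" "real_of_int (fst a) < M - M * \<delta>"
           "M * \<delta> < 1 + real_of_int (snd a)" "real_of_int (snd a) < M - M * \<delta>"
        using 2 M0 by (simp_all add: field_simps)
      then show ?thesis using \<delta>M by linarith
    qed
    define s where "s a = c + X \<bullet> jacobian \<phi> (at (z + ?v a))" for a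
    \<comment> \<open>The second term absorbs the error of the difference quotients. It uses up half
      of the lattice bound, hence the factor 2 in the final constant.\<close>
    define Z where "Z a = C * Y (z + ?v a) + \<epsilon> / 2" for a
    \<comment> \<open>Only the part of the gradient orthogonal to \<open>X\<close> contributes, and
      its norm is a summand of \<open>Y\<close>.\<close>
    have J: "\<bar>g \<bullet> (jacobian \<phi> (at x) *v d) - (g \<bullet> (X *v d)) * (X \<bullet> jacobian \<phi> (at x))\<bar> \<le> C * Y x"
      if "\<And>P. \<bar>g \<bullet> (P *v d)\<bar> \<le> C * norm P" for g d x
    proof -
      let ?t = "X \<bullet> jacobian \<phi> (at x)"
      have "g \<bullet> (jacobian \<phi> (at x) *v d) - (g \<bullet> (X *v d)) * ?t = g \<bullet> ((jacobian \<phi> (at x) - ?t *\<^sub>R X) *v d)"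
        by (simp add: matrix_vector_mult_diff_rdistrib inner_diff_right scaleR_matrix_vector_assoc[symmetric])
      then have "\<bar>g \<bullet> (jacobian \<phi> (at x) *v d) - (g \<bullet> (X *v d)) * ?t\<bar> \<le> C * norm (jacobian \<phi> (at x) - ?t *\<^sub>R X)"
        using that by simp
      also have "\<dots> \<le> C * Y x" using C(1) by (intro mult_left_mono) (auto simp: Y_def deviation_def)
      finally show ?thesis .
    qed
    have Q: "real_of_int M * x = x / (1 / real_of_int M)" for x by simp
    have "\<epsilon> * (real_of_int M)\<^sup>2 \<le> (\<Sum>a\<in>?Q. Z a)"
      unfolding \<epsilon>_def
    proof (rule lattice_concentration_bound[OF c M(1), where s = s and y = "\<lambda>a. \<alpha> \<bullet> \<phi> (z + ?v a)" and y' = "\<lambda>a. \<beta> \<bullet> \<phi> (z + ?v a)"])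
      fix a
      show "\<bar>M * (\<alpha> \<bullet> \<phi> (z + ?v (a + (1,1))) - \<alpha> \<bullet> \<phi> (z + ?v a))\<bar> \<le> Z a"
        using h1(2)[OF hM(1), of "z + ?v a"] hM(2) \<eta>(2) J[OF C(2), of "z + ?v a"] unfolding Q vd Z_def \<alpha> by linarith
      show "\<bar>M * (\<alpha> \<bullet> \<phi> (z + ?v (a + (1,-1))) - \<alpha> \<bullet> \<phi> (z + ?v a)) - (s a - c)\<bar> \<le> Z a"
        using h2(2)[OF hM(1), of "z + ?v a"] hM(2) \<eta>(3) J[OF C(3), of "z + ?v a"] unfolding Q vd Z_def \<alpha> s_def by linarith
      show "\<bar>M * (\<beta> \<bullet> \<phi> (z + ?v (a + (1,-1))) - \<beta> \<bullet> \<phi> (z + ?v a))\<bar> \<le> Z a"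
        using h4(2)[OF hM(1), of "z + ?v a"] hM(2) \<eta>(5) J[OF C(5), of "z + ?v a"] unfolding Q vd Z_def \<beta> by linarith
      show "\<bar>M * (\<beta> \<bullet> \<phi> (z + ?v (a + (1,1))) - \<beta> \<bullet> \<phi> (z + ?v a)) - (s a - c)\<bar> \<le> Z a"
        using h3(2)[OF hM(1), of "z + ?v a"] hM(2) \<eta>(4) J[OF C(4), of "z + ?v a"] unfolding Q vd Z_def \<beta> s_def by linarith
      have "1 * Y (z + ?v a) \<le> C * Y (z + ?v a)"
        using C(1) by (intro mult_right_mono) (auto simp: Y_def deviation_nonneg)
      then have YZ: "Y (z + ?v a) \<le> Z a" using \<epsilon> by (simp add: Z_def)
      have "max 0 (- s a) + min (max 0 (s a)) 1 \<le> Y (z + ?v a)" by (simp add: Y_def deviation_def s_def)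
      then show "- s a \<le> Z a" "min (s a) 1 \<le> Z a" using YZ by linarith+
    qed (use supp in blast)+
    also have "\<dots> = C * (\<Sum>a\<in>?Q. Y (z + ?v a)) + \<epsilon> / 2 * (real_of_int M)\<^sup>2"
      using M by (simp add: Z_def sum.distrib sum_distrib_left card_cartesian_product power2_eq_square)
    finally have "\<epsilon> * (real_of_int M)\<^sup>2 / 2 \<le> C * (\<Sum>a\<in>?Q. Y (z + ?v a))" by simp
    then show "\<epsilon> / (2 * C) * (real_of_int M)\<^sup>2 \<le> (\<Sum>a\<in>?Q. Y (z + ?v a))" using C(1) by (simp add: field_simps)
  qed (use M in \<open>auto simp: Y_def deviation_nonneg\<close>)
  then show ?thesis using M0 by (simp add: \<epsilon>_def Y_def)
qed

lemma deviation_lower_bound: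
  fixes X :: "real^'n^'m"
  assumes c: "c > 0" and X: "rank X \<ge> 2"
  shows "\<exists>\<epsilon>>0. \<forall>\<phi>\<in>test_functions unit_cube.
    \<epsilon> \<le> (LINT x:unit_cube|lborel. deviation c X (jacobian \<phi> (at x)))"
proof -
  obtain j1 j2 \<alpha>' \<beta>' where dual: "\<alpha>' \<bullet> column j1 X = 1" "\<alpha>' \<bullet> column j2 X = 0" "\<beta>' \<bullet> column j1 X = 0" "\<beta>' \<bullet> column j2 X = 1"
    by (rule rank_ge_2_dual_columns[OF X])
  have j: "j1 \<noteq> j2"
  proof
    assume "j1 = j2"
    then have "\<alpha>' \<bullet> column j1 X = 0" using dual(2) by simp
    then show False using dual(1) by simp
  qed
  define d1 :: "real^'n" where "d1 = axis j1 1 + axis j2 1"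
  define d2 :: "real^'n" where "d2 = axis j1 1 - axis j2 1"
  \<comment> \<open>\<open>X\<close> maps \<open>d1\<close> and \<open>d2\<close> to the sum and the
    difference of the two columns; the half sum and the half difference of the dual vectors are dual
    to these.\<close>
  define \<alpha> where "\<alpha> = (1/2) *\<^sub>R (\<alpha>' - \<beta>')"
  define \<beta> where "\<beta> = (1/2) *\<^sub>R (\<alpha>' + \<beta>')"
  have Xd: "X *v d1 = column j1 X + column j2 X" "X *v d2 = column j1 X - column j2 X"
    by (simp_all add: d1_def d2_def matrix_vector_right_distrib matrix_vector_mult_diff_distrib matrix_vector_mult_basis)
  have ab: "\<alpha> \<bullet> (X *v d1) = 0" "\<alpha> \<bullet> (X *v d2) = 1" "\<beta> \<bullet> (X *v d1) = 1" "\<beta> \<bullet> (X *v d2) = 0"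
    by (simp_all add: Xd \<alpha>_def \<beta>_def inner_add_left inner_add_right inner_diff_left inner_diff_right dual)
  obtain C1 where C1: "C1 \<ge> 0" "\<And>P::real^'n^'m. \<bar>\<alpha> \<bullet> (P *v d1)\<bar> \<le> C1 * norm P" using matrix_bilinear_bound by blast
  obtain C2 where C2: "C2 \<ge> 0" "\<And>P::real^'n^'m. \<bar>\<alpha> \<bullet> (P *v d2)\<bar> \<le> C2 * norm P" using matrix_bilinear_bound by blast
  obtain C3 where C3: "C3 \<ge> 0" "\<And>P::real^'n^'m. \<bar>\<beta> \<bullet> (P *v d1)\<bar> \<le> C3 * norm P" using matrix_bilinear_bound by blast
  obtain C4 where C4: "C4 \<ge> 0" "\<And>P::real^'n^'m. \<bar>\<beta> \<bullet> (P *v d2)\<bar> \<le> C4 * norm P" using matrix_bilinear_bound by blast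
  define C where "C = 1 + C1 + C2 + C3 + C4"
  have le: "C1 \<le> C" "C2 \<le> C" "C3 \<le> C" "C4 \<le> C" "1 \<le> C"
    using C1(1) C2(1) C3(1) C4(1) by (auto simp: C_def)
  note up = order_trans[OF _ mult_right_mono[OF _ norm_ge_zero]]
  show ?thesis
  proof (intro exI[of _ "min (1/800) (c/10) / (2 * C)"] conjI ballI)
    show "min (1/800) (c/10) / (2 * C) > 0" using c le(5) by simp
    fix \<phi> :: "real^'n \<Rightarrow> real^'m" assume tf: "\<phi> \<in> test_functions unit_cube"
    show "min (1/800) (c/10) / (2 * C) \<le> (LINT x:unit_cube|lborel. deviation c X (jacobian \<phi> (at x)))"
      by (rule gradient_lattice_bound[OF c tf d1_def d2_def ab j le(5)
            up[OF C1(2) le(1)] up[OF C2(2) le(2)] up[OF C3(2) le(3)] up[OF C4(2) le(4)]])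
  qed
qed

lemma rank_scaleR:
  fixes A :: "real^'n^'m"
  assumes "r \<noteq> 0"
  shows "rank (r *\<^sub>R A) = rank A"
proof -
  have *: "rank (r *\<^sub>R A) \<le> rank A" for r and A :: "real^'n^'m"
  proof -
    have "r *\<^sub>R A = mat r ** A"
      by (simp add: vec_eq_iff matrix_matrix_mult_def mat_def if_distrib[of "\<lambda>x. x * _"] cong: if_cong)
    then show ?thesis by (simp add: rank_mul_le_right)
  qed
  from *[of r A] *[of "1 / r" "r *\<^sub>R A"] assms show ?thesis by simp
qed

lemma quasiconvex_envelope_gt_huber:
  fixes \<xi> :: "real^'n^'m"
  assumes l: "l > 0" and \<xi>: "norm \<xi> > l / 2" "rank \<xi> \<ge> 2"
  shows "huber l \<xi> < quasiconvex_envelope (h_simp l) \<xi>"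
proof -
  have n0: "norm \<xi> > 0" using l \<xi> by linarith
  define X where "X = (1 / norm \<xi>) *\<^sub>R \<xi>"
  define c where "c = norm \<xi> - l / 2"
  have c: "c > 0" using \<xi> by (simp add: c_def)
  have X1: "norm X = 1" and X\<xi>: "\<xi> = norm \<xi> *\<^sub>R X" using n0 by (simp_all add: X_def)
  have XX: "X \<bullet> X = 1" using X1 by (simp add: norm_eq_1)
  have "rank X \<ge> 2" using \<xi>(2) n0 rank_scaleR[of "1 / norm \<xi>" \<xi>] by (simp add: X_def)
  then obtain \<epsilon> where \<epsilon>: "\<epsilon> > 0"
    "\<And>\<phi>. \<phi> \<in> test_functions unit_cube \<Longrightarrow> \<epsilon> \<le> (LINT x:unit_cube|lborel. deviation c X (jacobian \<phi> (at x)))"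
    using deviation_lower_bound[OF c] by blast
  \<comment> \<open>\<open>K\<close> is the mean of the factor \<open>1 + l + \<sigma>\<close> in
    \<open>excess_bound\<close>, because \<sigma> has mean \<open>norm \<xi>\<close>. The choice of
    \<tau> makes that term cost exactly half of \<epsilon>.\<close>
  define K where "K = 1 + l + norm \<xi>"
  have K: "K > 0" using l by (simp add: K_def add_pos_nonneg)
  define \<tau> where "\<tau> = \<epsilon> / (2 * K)"
  have \<tau>: "\<tau> > 0" using \<epsilon> K by (simp add: \<tau>_def)
  define C where "C = 1 / (2 * \<tau>) + 4 / l\<^sup>2 + 2 / l + (1 + 1 / \<tau> + \<tau>) / l"
  have C: "C > 0" using \<tau> l unfolding C_def by (intro add_pos_pos divide_pos_pos) auto
  have "huber l \<xi> + \<epsilon> / (2 * C) \<le> quasiconvex_envelope (h_simp l) \<xi>"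
  proof (rule quasiconvex_envelope_ge)
    fix \<phi> :: "real^'n \<Rightarrow> real^'m" assume tf: "\<phi> \<in> test_functions unit_cube"
    define J where "J x = jacobian \<phi> (at x)" for x
    define D where "D x = h_simp l (\<xi> + J x) - huber l \<xi> - (l *\<^sub>R X) \<bullet> J x" for x
    have pt: "deviation c X (J x) \<le> \<tau> * K + (\<tau> *\<^sub>R X) \<bullet> J x + C * D x" for x
    proof -
      define t where "t = X \<bullet> J x"
      define P where "P = J x - t *\<^sub>R X"
      have XP: "X \<bullet> P = 0" by (simp add: P_def inner_diff_right XX t_def)
      have "\<xi> + J x = (norm \<xi> + t) *\<^sub>R X + P"
        using X\<xi> by (simp add: P_def scaleR_add_left)
      then have nn: "(norm (\<xi> + J x))\<^sup>2 = (norm \<xi> + t)\<^sup>2 + (norm P)\<^sup>2"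
        by (simp add: power2_norm_eq_inner inner_add_left inner_add_right XX XP inner_commute[of P X])
           (simp add: power2_eq_square)
      have "D x = min ((norm (\<xi> + J x))\<^sup>2) (l * norm (\<xi> + J x)) - l\<^sup>2 / 4 - l * ((norm \<xi> + t) - l / 2)"
        using \<xi>(1) by (simp add: D_def h_simp_def huber_def t_def power2_eq_square algebra_simps)
      from excess_bound[OF l \<tau> norm_ge_zero norm_ge_zero nn this, folded C_def]
      have "norm P + max 0 (l / 2 - (norm \<xi> + t)) + min (max 0 (norm \<xi> + t - l / 2)) 1
          \<le> \<tau> * (1 + l + (norm \<xi> + t)) + C * D x" .
      moreover have "l / 2 - (norm \<xi> + t) = - (c + t)" "norm \<xi> + t - l / 2 = c + t" by (simp_all add: c_def)
      ultimately have "deviation c X (J x) \<le> \<tau> * (1 + l + (norm \<xi> + t)) + C * D x"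
        by (simp only: deviation_def t_def[symmetric] P_def)
      then show ?thesis by (simp add: K_def t_def algebra_simps)
    qed
    have iJ: "set_integrable lborel unit_cube (\<lambda>x. (\<tau> *\<^sub>R X) \<bullet> J x)"
      unfolding J_def by (intro set_integrable_unit_cube continuous_intros test_function_jacobian_continuous[OF tf])
    have ih: "continuous_on UNIV (\<lambda>x. h_simp l (\<xi> + J x))"
      unfolding J_def
      by (rule continuous_on_compose2[OF continuous_on_h_simp[of UNIV]])
         (auto intro!: continuous_intros test_function_jacobian_continuous[OF tf])
    have iD: "set_integrable lborel unit_cube D"
      unfolding D_def by (intro set_integrable_unit_cube continuous_intros ih, unfold J_def)
        (rule test_function_jacobian_continuous[OF tf])
    have ic: "set_integrable lborel unit_cube (\<lambda>x::real^'n. \<tau> * K)"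
      by (intro set_integrable_unit_cube continuous_intros)
    have idv: "set_integrable lborel unit_cube (\<lambda>x. deviation c X (J x))"
      unfolding J_def deviation_def
      by (intro set_integrable_unit_cube continuous_intros test_function_jacobian_continuous[OF tf])
    have iCD: "set_integrable lborel unit_cube (\<lambda>x. C * D x)" using iD by simp
    have "\<epsilon> \<le> (LINT x:unit_cube|lborel. deviation c X (J x))" using \<epsilon>(2)[OF tf] by (simp add: J_def)
    also have "\<dots> \<le> (LINT x:unit_cube|lborel. \<tau> * K + (\<tau> *\<^sub>R X) \<bullet> J x + C * D x)"
      by (intro set_integral_mono idv set_integral_add(1) ic iJ iCD pt)
    also have "\<dots> = \<tau> * K + (LINT x:unit_cube|lborel. (\<tau> *\<^sub>R X) \<bullet> J x) + C * (LINT x:unit_cube|lborel. D x)"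
      by (subst set_integral_add(2)[OF set_integral_add(1)[OF ic iJ] iCD], subst set_integral_add(2)[OF ic iJ]) simp
    also have "(LINT x:unit_cube|lborel. (\<tau> *\<^sub>R X) \<bullet> J x) = 0"
      unfolding J_def by (rule test_function_integral_jacobian[OF tf])
    also have "(LINT x:unit_cube|lborel. D x) = (LINT x:unit_cube|lborel. h_simp l (\<xi> + J x)) - huber l \<xi>"
      unfolding D_def J_def by (rule energy_excess[OF tf])
    finally have "\<epsilon> \<le> \<tau> * K + C * ((LINT x:unit_cube|lborel. h_simp l (\<xi> + J x)) - huber l \<xi>)" by simp
    moreover have "\<tau> * K = \<epsilon> / 2" using K by (simp add: \<tau>_def)
    ultimately have "\<epsilon> / 2 \<le> C * ((LINT x:unit_cube|lborel. h_simp l (\<xi> + J x)) - huber l \<xi>)" by simp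
    then have "\<epsilon> / (2 * C) \<le> (LINT x:unit_cube|lborel. h_simp l (\<xi> + J x)) - huber l \<xi>"
      using C by (simp add: field_simps)
    then show "huber l \<xi> + \<epsilon> / (2 * C) \<le> (LINT x:unit_cube|lborel. h_simp l (\<xi> + jacobian \<phi> (at x)))"
      by (simp add: J_def)
  qed
  moreover have "\<epsilon> / (2 * C) > 0" using \<epsilon> C by simp
  ultimately show ?thesis by linarith
qed

subsection \<open>Smooth functions\<close>

lemma C_order_SucI:
  assumes "\<And>x. (f has_derivative D x) (at x)" "\<And>j. C_order k (\<lambda>x. D x (axis j 1))"
  shows "C_order (Suc k) f"
proof -
  have "frechet_derivative f (at x) = D x" for x
    using frechet_derivative_at[OF assms(1)] by simp
  then show ?thesis using assms by (auto simp: differentiable_def)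
qed

lemma C_order_SucD:
  assumes "C_order (Suc k) f"
  shows "(f has_derivative frechet_derivative f (at x)) (at x)"
    "C_order k (\<lambda>x. frechet_derivative f (at x) (axis j 1))"
  using assms by (auto simp: frechet_derivative_works[symmetric])

lemma C_order_Suc_imp: "C_order (Suc k) f \<Longrightarrow> C_order k f"
proof (induction k arbitrary: f)
  case 0
  then show ?case
    by (auto intro!: continuous_at_imp_continuous_on differentiable_imp_continuous_within)
next
  case (Suc k)
  show ?case
    by (rule C_order_SucI[OF C_order_SucD(1)[OF Suc.prems]]) (rule Suc.IH[OF C_order_SucD(2)[OF Suc.prems]])
qed

lemma C_order_add: "C_order k f \<Longrightarrow> C_order k g \<Longrightarrow> C_order k (\<lambda>x. f x + g x)"
proof (induction k arbitrary: f g)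
  case 0
  then show ?case by (auto intro: continuous_intros)
next
  case (Suc k)
  show ?case
    by (rule C_order_SucI[OF has_derivative_add[OF C_order_SucD(1)[OF Suc.prems(1)] C_order_SucD(1)[OF Suc.prems(2)]]])
       (intro Suc.IH C_order_SucD(2)[OF Suc.prems(1)] C_order_SucD(2)[OF Suc.prems(2)])
qed

lemma C_order_mult:
  fixes f g :: "real^'n \<Rightarrow> real"
  shows "C_order k f \<Longrightarrow> C_order k g \<Longrightarrow> C_order k (\<lambda>x. f x * g x)"
proof (induction k arbitrary: f g)
  case 0
  then show ?case by (auto intro: continuous_intros)
next
  case (Suc k)
  show ?case
    by (rule C_order_SucI[OF has_derivative_mult[OF C_order_SucD(1)[OF Suc.prems(1)] C_order_SucD(1)[OF Suc.prems(2)]]])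
       (intro C_order_add Suc.IH C_order_SucD(2)[OF Suc.prems(1)] C_order_SucD(2)[OF Suc.prems(2)]
          C_order_Suc_imp[OF Suc.prems(1)] C_order_Suc_imp[OF Suc.prems(2)])
qed

lemma C_order_minus:
  fixes f :: "real^'n \<Rightarrow> real"
  shows "C_order k f \<Longrightarrow> C_order k (\<lambda>x. - f x)"
  using C_order_mult[OF C_order_const[of k "-1"], of f] by simp

lemma C_order_diff:
  fixes f g :: "real^'n \<Rightarrow> real"
  shows "C_order k f \<Longrightarrow> C_order k g \<Longrightarrow> C_order k (\<lambda>x. f x - g x)"
  using C_order_add[OF _ C_order_minus, of k f g] by simp

lemma C_order_scaleR_left:
  fixes f :: "real^'n \<Rightarrow> real" and a :: "'b::real_normed_vector"
  shows "C_order k f \<Longrightarrow> C_order k (\<lambda>x. f x *\<^sub>R a)"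
proof (induction k arbitrary: f)
  case 0
  then show ?case by (auto intro: continuous_intros)
next
  case (Suc k)
  show ?case
    by (rule C_order_SucI[OF has_derivative_scaleR_left[OF C_order_SucD(1)[OF Suc.prems]]])
       (intro Suc.IH C_order_SucD(2)[OF Suc.prems])
qed

lemma C_order_inner: "C_order k (\<lambda>x::real^'n. e \<bullet> x)"
proof (cases k)
  case 0
  then show ?thesis by (auto intro: continuous_intros)
next
  case (Suc k')
  have "((\<lambda>x::real^'n. e \<bullet> x) has_derivative (\<lambda>h. e \<bullet> h)) (at x)" for x
    by (auto intro!: derivative_eq_intros)
  then show ?thesis unfolding Suc by (rule C_order_SucI) (rule C_order_const)
qed

lemma C_order_nth: "C_order k (\<lambda>x::real^'n. x $ j)"
  using C_order_inner[of k "axis j 1"] by (simp add: inner_axis inner_commute)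

text \<open>The index lets the induction stay inside a family closed under differentiation, as for
  \<open>exp\<close> or for sine shifted by multiples of \<open>pi / 2\<close>.\<close>

lemma C_order_compose:
  fixes f :: "real^'n \<Rightarrow> real" and F :: "'i \<Rightarrow> real \<Rightarrow> real"
  assumes "\<And>i t. (F i has_real_derivative F (d i) t) (at t)"
  shows "C_order k f \<Longrightarrow> C_order k (\<lambda>x. F i (f x))"
proof (induction k arbitrary: i)
  case 0
  have "continuous_on UNIV (F i)"
    using assms DERIV_isCont continuous_at_imp_continuous_on by blast
  then show ?case using 0 continuous_on_compose2[of UNIV "F i" UNIV f] by auto
next
  case (Suc k)
  have "((\<lambda>x. F i (f x)) has_derivative (\<lambda>h. F (d i) (f x) * frechet_derivative f (at x) h)) (at x)" for x
    using has_derivative_compose[OF C_order_SucD(1)[OF Suc.prems] assms[unfolded has_field_derivative_def]]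
    by (simp add: mult.commute)
  then show ?case
    by (rule C_order_SucI)
       (intro C_order_mult Suc.IH C_order_SucD(2)[OF Suc.prems] C_order_Suc_imp[OF Suc.prems])
qed

lemma C_order_exp:
  fixes f :: "real^'n \<Rightarrow> real"
  shows "C_order k f \<Longrightarrow> C_order k (\<lambda>x. exp (f x))"
  by (rule C_order_compose[where F = "\<lambda>_::unit. exp"]) (auto intro: derivative_eq_intros)

lemma C_order_sin_shift:
  fixes f :: "real^'n \<Rightarrow> real"
  shows "C_order k f \<Longrightarrow> C_order k (\<lambda>x. sin (f x + b))"
  by (rule C_order_compose[where F = "\<lambda>b t. sin (t + b)" and d = "\<lambda>b. b + pi / 2"])
     (auto intro!: derivative_eq_intros simp: sin_add cos_add)

lemma C_order_sin:
  fixes f :: "real^'n \<Rightarrow> real"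
  shows "C_order k f \<Longrightarrow> C_order k (\<lambda>x. sin (f x))"
  using C_order_sin_shift[of k f 0] by simp

lemma C_order_cos:
  fixes f :: "real^'n \<Rightarrow> real"
  shows "C_order k f \<Longrightarrow> C_order k (\<lambda>x. cos (f x))"
  using C_order_sin_shift[of k f "pi / 2"] by (simp add: sin_add)

lemma C_order_inverse:
  fixes f :: "real^'n \<Rightarrow> real"
  assumes "\<And>x. f x \<noteq> 0"
  shows "C_order k f \<Longrightarrow> C_order k (\<lambda>x. inverse (f x))"
proof (induction k)
  case 0
  then show ?case using assms by (auto intro!: continuous_intros)
next
  case (Suc k)
  show ?case
    by (rule C_order_SucI[OF Deriv.has_derivative_inverse[OF assms C_order_SucD(1)[OF Suc.prems]]])
       (intro C_order_minus C_order_mult Suc.IH C_order_SucD(2)[OF Suc.prems] C_order_Suc_imp[OF Suc.prems])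
qed

lemma C_order_arctan:
  fixes f :: "real^'n \<Rightarrow> real"
  assumes "C_order k f"
  shows "C_order k (\<lambda>x. arctan (f x))"
proof (cases k)
  case 0
  then show ?thesis using assms by (auto intro: continuous_intros)
next
  case (Suc k')
  have f: "C_order (Suc k') f" using assms Suc by simp
  have nz: "1 + f x * f x \<noteq> 0" for x
    using zero_le_square[of "f x"] by linarith
  have "((\<lambda>x. arctan (f x)) has_derivative (\<lambda>h. inverse (1 + f x * f x) * frechet_derivative f (at x) h)) (at x)" for x
    using has_derivative_compose[OF C_order_SucD(1)[OF f] DERIV_arctan[unfolded has_field_derivative_def]]
    by (simp add: power2_eq_square)
  then show ?thesis unfolding Suc
    by (rule C_order_SucI)
       (intro C_order_mult C_order_inverse nz C_order_add C_order_const C_order_SucD(2)[OF f] C_order_Suc_imp[OF f])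
qed

lemma C_order_prod:
  fixes f :: "'i \<Rightarrow> real^'n \<Rightarrow> real"
  assumes "\<And>i. i \<in> A \<Longrightarrow> C_order k (f i)"
  shows "C_order k (\<lambda>x. \<Prod>i\<in>A. f i x)"
  using assms
  by (induction A rule: infinite_finite_induct) (simp_all add: C_order_const C_order_mult)

section \<open>A smooth cutoff for the unit cube\<close>

definition flat :: "nat \<Rightarrow> real \<Rightarrow> real" where
  "flat n t = (if t \<le> 0 then 0 else exp (- inverse t) * inverse t ^ n)"

lemma flat_0_right: "(flat n \<longlongrightarrow> 0) (at_right 0)"
proof -
  have "((\<lambda>y::real. y ^ n / exp y) \<longlongrightarrow> 0) at_top" by (rule tendsto_power_div_exp_0)
  then have "((\<lambda>t::real. inverse t ^ n / exp (inverse t)) \<longlongrightarrow> 0) (at_right 0)"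
    by (rule filterlim_compose) (rule filterlim_inverse_at_top_right)
  moreover have "eventually (\<lambda>t. inverse t ^ n / exp (inverse t) = flat n t) (at_right 0)"
    by (rule eventually_mono[OF eventually_at_right_less]) (simp add: flat_def exp_minus field_simps)
  ultimately show ?thesis by (simp add: tendsto_cong)
qed

text \<open>Carrying powers of \<open>1 / t\<close> closes the family under differentiation up to
  linear combinations. Smoothness at 0 holds because the exponential beats every power.\<close>

lemma flat_has_derivative: "(flat n has_real_derivative flat (n + 2) t - real n * flat (n + 1) t) (at t)"
proof -
  consider "t < 0" | "t = 0" | "t > 0" by linarith
  then show ?thesis
  proof cases
    case 1
    have "((\<lambda>_. 0) has_real_derivative 0) (at t)" by simp
    then have "(flat n has_real_derivative 0) (at t)"
      by (rule has_field_derivative_transform_within_open[of _ _ _ "{..<0}"]) (use 1 in \<open>auto simp: flat_def\<close>)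
    then show ?thesis using 1 by (simp add: flat_def)
  next
    case 2
    have "(flat (n + 1) \<longlongrightarrow> 0) (at 0)"
    proof (subst filterlim_at_split, intro conjI flat_0_right)
      have "eventually (\<lambda>t. 0 = flat (n + 1) t) (at_left 0)"
        by (rule eventually_mono[OF eventually_at_left_field[THEN iffD2]]) (auto simp: flat_def intro: exI[of _ "-1"])
      then show "(flat (n + 1) \<longlongrightarrow> 0) (at_left 0)" by (rule tendsto_eventually[OF eventually_mono]) simp
    qed
    \<comment> \<open>Dividing by \<open>h\<close> raises the power by one, so the difference
      quotient at 0 is again a member of the family and tends to 0.\<close>
    moreover have "flat n h / h = flat (n + 1) h" for h by (simp add: flat_def field_simps)
    moreover have "flat m 0 = 0" for m by (simp add: flat_def)
    ultimately show ?thesis unfolding 2 DERIV_def by simp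
  next
    case 3
    have "((\<lambda>t. exp (- inverse t) * inverse t ^ n) has_real_derivative
        exp (- inverse t) * inverse t ^ (n + 2) - real n * (exp (- inverse t) * inverse t ^ (n + 1))) (at t)"
    proof -
      have "((\<lambda>t. exp (- inverse t) * inverse t ^ n) has_real_derivative
          exp (- inverse t) * (inverse t)\<^sup>2 * inverse t ^ n
          + exp (- inverse t) * (real n * inverse t ^ (n - 1) * - (inverse t)\<^sup>2)) (at t)"
        using 3 by (auto intro!: derivative_eq_intros simp: power2_eq_square)
      then show ?thesis by (cases n) (simp_all add: power2_eq_square algebra_simps)
    qed
    then have "(flat n has_real_derivative
        exp (- inverse t) * inverse t ^ (n + 2) - real n * (exp (- inverse t) * inverse t ^ (n + 1))) (at t)"
      by (rule has_field_derivative_transform_within_open[of _ _ _ "{0<..}"]) (use 3 in \<open>auto simp: flat_def\<close>)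
    then show ?thesis using 3 by (simp add: flat_def)
  qed
qed

lemma flat_nonneg: "0 \<le> flat n t" and flat_pos: "0 < t \<Longrightarrow> 0 < flat n t"
  by (simp_all add: flat_def)

lemma flat_nonpos_eq: "t \<le> 0 \<Longrightarrow> flat n t = 0" by (simp add: flat_def)

lemma continuous_on_flat: "continuous_on A (flat n)"
  using flat_has_derivative DERIV_isCont continuous_at_imp_continuous_on by blast

lemma C_order_flat:
  fixes f :: "real^'n \<Rightarrow> real"
  shows "C_order k f \<Longrightarrow> C_order k (\<lambda>x. flat n (f x))"
proof (induction k arbitrary: n)
  case 0
  then show ?case using continuous_on_compose2[OF continuous_on_flat[of UNIV n], of UNIV f] by simp
next
  case (Suc k)
  have "((\<lambda>x. flat n (f x)) has_derivative
      (\<lambda>h. (flat (n + 2) (f x) - real n * flat (n + 1) (f x)) * frechet_derivative f (at x) h)) (at x)" for x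
    using has_derivative_compose[OF C_order_SucD(1)[OF Suc.prems] flat_has_derivative[unfolded has_field_derivative_def]]
    by simp
  then show ?case
    by (rule C_order_SucI)
       (intro C_order_mult C_order_diff C_order_const Suc.IH C_order_SucD(2)[OF Suc.prems] C_order_Suc_imp[OF Suc.prems])
qed

text \<open>The product is positive exactly when all coordinates lie strictly between
  \<open>1 / N\<close> and \<open>1 - 1 / N\<close>. The factor \<open>N\<close> in the exponent
  then drives the value to 1 at each point of the cube; this pointwise limit is all that dominated
  convergence asks for.\<close>

definition cutoff :: "nat \<Rightarrow> real^'n \<Rightarrow> real" where
  "cutoff N x = 1 - exp (- (real N * (\<Prod>j\<in>UNIV. flat 0 (x $ j - 1 / N) * flat 0 (1 - 1 / N - x $ j))))"

lemma C_order_cutoff: "C_order k (cutoff N)"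
  unfolding cutoff_def
  by (intro C_order_diff C_order_const C_order_exp C_order_minus C_order_mult C_order_prod C_order_flat C_order_nth)

lemma cutoff_bounds: "0 \<le> cutoff N x" "cutoff N x \<le> 1"
proof -
  have "0 \<le> real N * (\<Prod>j\<in>UNIV. flat 0 (x $ j - 1 / N) * flat 0 (1 - 1 / N - x $ j))"
    by (intro mult_nonneg_nonneg prod_nonneg) (auto simp: flat_nonneg)
  then show "0 \<le> cutoff N x" "cutoff N x \<le> 1" by (simp_all add: cutoff_def)
qed

lemma cutoff_support: "cutoff N x \<noteq> 0 \<Longrightarrow> 1 / N \<le> x $ j \<and> x $ j \<le> 1 - 1 / N"
proof (rule ccontr)
  assume x: "cutoff N x \<noteq> 0" "\<not> (1 / N \<le> x $ j \<and> x $ j \<le> 1 - 1 / N)"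
  then have "flat 0 (x $ j - 1 / N) * flat 0 (1 - 1 / N - x $ j) = 0"
    by (auto intro: flat_nonpos_eq simp: not_le)
  then have "(\<Prod>j\<in>UNIV. flat 0 (x $ j - 1 / N) * flat 0 (1 - 1 / N - x $ j)) = 0"
    by (intro prod_zero) auto
  then show False using x by (simp add: cutoff_def)
qed

lemma cutoff_tendsto:
  assumes x: "x \<in> unit_cube"
  shows "(\<lambda>N. cutoff N x) \<longlonglongrightarrow> 1"
proof -
  define p where "p = (\<Prod>j\<in>UNIV. flat 0 (x $ j) * flat 0 (1 - x $ j))"
  have p: "p > 0" using x unfolding p_def by (intro prod_pos) (auto simp: unit_cube_def intro!: mult_pos_pos flat_pos)
  have c: "isCont (flat 0) t" for t using flat_has_derivative DERIV_isCont by blast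
  have N: "(\<lambda>N. 1 / real N) \<longlonglongrightarrow> 0" by (rule lim_1_over_n)
  have "(\<lambda>N. \<Prod>j\<in>UNIV. flat 0 (x $ j - 1 / N) * flat 0 (1 - 1 / N - x $ j)) \<longlonglongrightarrow>
       (\<Prod>j\<in>UNIV. flat 0 (x $ j - 0) * flat 0 (1 - 0 - x $ j))"
    by (intro tendsto_prod tendsto_mult isCont_tendsto_compose[OF c] tendsto_diff tendsto_const N)
  then have "(\<lambda>N. \<Prod>j\<in>UNIV. flat 0 (x $ j - 1 / N) * flat 0 (1 - 1 / N - x $ j)) \<longlonglongrightarrow> p" by (simp add: p_def)
  then have "filterlim (\<lambda>N. (\<Prod>j\<in>UNIV. flat 0 (x $ j - 1 / N) * flat 0 (1 - 1 / N - x $ j)) * real N) at_top sequentially"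
    by (rule filterlim_tendsto_pos_mult_at_top[OF _ p filterlim_real_sequentially])
  then have "(\<lambda>N. exp (- (real N * (\<Prod>j\<in>UNIV. flat 0 (x $ j - 1 / N) * flat 0 (1 - 1 / N - x $ j))))) \<longlonglongrightarrow> 0"
    by (intro filterlim_compose[OF exp_at_bot] filterlim_uminus_at_bot_at_top[THEN filterlim_compose]) (simp add: mult.commute)
  from tendsto_diff[OF tendsto_const[of 1] this] show ?thesis by (simp add: cutoff_def)
qed

section \<open>The Poisson kernel and a bounded primitive\<close>

definition poisson :: "real \<Rightarrow> real \<Rightarrow> real" where
  "poisson r z = (1 - r\<^sup>2) / (1 - 2 * r * cos z + r\<^sup>2)"

text \<open>This is -2 times the argument of \<open>1 - r * e^(i z)\<close>, with Fourier series
  \<open>2 * r^k * sin (k z) / k\<close> summed over \<open>k \<ge> 1\<close>. As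
  \<open>1 - r * cos z\<close> is positive, the arctangent gives a smooth periodic function on the
  whole line, bounded independently of \<open>r\<close>.\<close>

definition poisson_primitive :: "real \<Rightarrow> real \<Rightarrow> real" where
  "poisson_primitive r z = 2 * arctan (r * sin z * inverse (1 - r * cos z))"

context
  fixes r :: real
  assumes r: "0 < r" "r < 1"
begin

lemma r_cos_less: "r * cos z < 1"
proof -
  have "r * cos z \<le> r * 1" using r by (intro mult_left_mono) auto
  then show ?thesis using r by linarith
qed

lemma poisson_denominator: "0 < 1 - 2 * r * cos z + r\<^sup>2"
proof -
  have "r * cos z \<le> r * 1" using r by (intro mult_left_mono) auto
  moreover have "0 < (1 - r)\<^sup>2" using r by simp
  ultimately show ?thesis by (simp add: power2_eq_square algebra_simps)
qed

lemma poisson_nonneg: "0 \<le> poisson r z"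
  unfolding poisson_def using r poisson_denominator[of z]
  by (intro divide_nonneg_pos) (auto simp: power2_eq_square intro!: mult_le_one)

lemma poisson_primitive_bound: "\<bar>poisson_primitive r z\<bar> \<le> pi"
  using arctan_lbound[of "r * sin z * inverse (1 - r * cos z)"] arctan_ubound[of "r * sin z * inverse (1 - r * cos z)"]
  by (auto simp: poisson_primitive_def)

lemma poisson_primitive_has_derivative:
  "(poisson_primitive r has_real_derivative poisson r z - 1) (at z)"
proof -
  let ?d = "1 - r * cos z"
  have d: "?d \<noteq> 0" using r_cos_less[of z] by simp
  \<comment> \<open>Both sides are the squared modulus of \<open>1 - r * e^(i z)\<close>.\<close>
  have q: "1 - 2 * r * cos z + r\<^sup>2 = ?d\<^sup>2 + (r * sin z)\<^sup>2"
    using sin_cos_squared_add[of z] by algebra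
  have nz: "?d\<^sup>2 + (r * sin z)\<^sup>2 \<noteq> 0" using poisson_denominator[of z] unfolding q by linarith
  have "(poisson_primitive r has_real_derivative
      2 * (inverse (1 + (r * sin z * inverse ?d)\<^sup>2) *
        (r * cos z * inverse ?d + (- (inverse ?d * (r * sin z) * inverse ?d)) * (r * sin z)))) (at z)"
    unfolding poisson_primitive_def[abs_def] using d
    by (auto intro!: derivative_eq_intros)
  moreover have "2 * (inverse (1 + (r * sin z * inverse ?d)\<^sup>2) *
        (r * cos z * inverse ?d + (- (inverse ?d * (r * sin z) * inverse ?d)) * (r * sin z))) = poisson r z - 1"
  proof -
    have 1: "1 + (r * sin z * inverse ?d)\<^sup>2 = (?d\<^sup>2 + (r * sin z)\<^sup>2) / ?d\<^sup>2"
    proof -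
      have "1 + (x * inverse y)\<^sup>2 = (y\<^sup>2 + x\<^sup>2) / y\<^sup>2" if "y \<noteq> 0" for x y :: real
        using that by (simp add: field_simps)
      from this[OF d] show ?thesis .
    qed
    have 2: "r * cos z * inverse ?d + (- (inverse ?d * (r * sin z) * inverse ?d)) * (r * sin z)
        = (r * cos z * ?d - (r * sin z)\<^sup>2) / ?d\<^sup>2"
    proof -
      have "u * inverse y + (- (inverse y * x * inverse y)) * x = (u * y - x\<^sup>2) / y\<^sup>2" if "y \<noteq> 0" for u x y :: real
        using that by (simp add: field_simps power2_eq_square)
      from this[OF d] show ?thesis .
    qed
    have "2 * (inverse (1 + (r * sin z * inverse ?d)\<^sup>2) *
        (r * cos z * inverse ?d + (- (inverse ?d * (r * sin z) * inverse ?d)) * (r * sin z)))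
        = 2 * (r * cos z * ?d - (r * sin z)\<^sup>2) / (?d\<^sup>2 + (r * sin z)\<^sup>2)"
      unfolding 1 2 using d by simp
    also have "2 * (r * cos z * ?d - (r * sin z)\<^sup>2) = (1 - r\<^sup>2) - (?d\<^sup>2 + (r * sin z)\<^sup>2)"
      using sin_cos_squared_add[of z] by algebra
    finally show ?thesis unfolding poisson_def q using nz by (simp add: diff_divide_distrib)
  qed
  ultimately show ?thesis by simp
qed

lemma C_order_poisson_primitive:
  fixes f :: "real^'n \<Rightarrow> real"
  assumes "C_order k f"
  shows "C_order k (\<lambda>x. poisson_primitive r (f x))"
  unfolding poisson_primitive_def
proof (intro C_order_mult C_order_arctan C_order_inverse C_order_diff C_order_const C_order_sin C_order_cos assms)
  show "1 - r * cos (f x) \<noteq> 0" for x using r_cos_less[of "f x"] by simp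
qed

end

lemma poisson_tendsto_0:
  assumes r: "r \<longlonglongrightarrow> 1" and z: "cos z \<noteq> 1"
  shows "(\<lambda>n. poisson (r n) z) \<longlonglongrightarrow> 0"
proof -
  have "(\<lambda>n. poisson (r n) z) \<longlonglongrightarrow> (1 - 1\<^sup>2) / (1 - 2 * 1 * cos z + 1\<^sup>2)"
    unfolding poisson_def by (intro tendsto_intros r) (use z in simp)
  then show ?thesis by simp
qed

subsection \<open>Laminates for matrices of rank one\<close>

definition outer :: "real^'m \<Rightarrow> real^'n \<Rightarrow> real^'n^'m" where
  "outer a v = (\<chi> i j. a $ i * v $ j)"

lemma norm_outer: "norm (outer a v) = norm a * norm v"
proof -
  have "(norm (outer a v))\<^sup>2 = (\<Sum>i\<in>UNIV. (a $ i)\<^sup>2) * (\<Sum>j\<in>UNIV. (v $ j)\<^sup>2)"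
    by (simp add: norm_matrix_eq_frobenius outer_def power_mult_distrib sum_product)
  also have "\<dots> = (norm a * norm v)\<^sup>2"
    by (simp add: power_mult_distrib norm_vec_def L2_set_def sum_nonneg)
  finally show ?thesis by (simp add: power2_eq_iff_nonneg)
qed

lemma outer_add: "outer a (v + w) = outer a v + outer a w"
  by (simp add: outer_def vec_eq_iff algebra_simps)

lemma outer_scaleR: "outer a (c *\<^sub>R v) = c *\<^sub>R outer a v"
  by (simp add: outer_def vec_eq_iff)

lemma outer_inner_outer: "outer a v \<bullet> outer a w = (norm a)\<^sup>2 * (v \<bullet> w)"
proof -
  have "outer a v \<bullet> outer a w = (\<Sum>i\<in>UNIV. \<Sum>j\<in>UNIV. (a $ i * a $ i) * (v $ j * w $ j))"
    by (simp add: inner_vec_def outer_def mult_ac)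
  also have "\<dots> = (a \<bullet> a) * (v \<bullet> w)" by (simp add: inner_vec_def sum_product)
  finally show ?thesis by (simp add: power2_norm_eq_inner)
qed

lemma rank_le_1_outer:
  fixes \<xi> :: "real^'n^'m"
  assumes "rank \<xi> \<le> 1" "\<xi> \<noteq> 0"
  obtains a e where "norm a = 1" "norm e = 1" "\<xi> = norm \<xi> *\<^sub>R outer a e"
proof -
  obtain i0 where i0: "row i0 \<xi> \<noteq> 0" using assms(2) by (auto simp: vec_eq_iff row_def)
  define w where "w = row i0 \<xi>"
  have w: "w \<noteq> 0" using i0 by (simp add: w_def)
  \<comment> \<open>A single nonzero row is already a maximal independent set of rows when the row
    rank is at most one.\<close>
  have "rows \<xi> \<subseteq> span {w}"
    by (rule card_ge_dim_independent) (use w assms(1) in \<open>auto simp: w_def rows_def row_rank_def\<close>)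
  then have "\<forall>i. \<exists>k. row i \<xi> = k *\<^sub>R w" by (auto simp: rows_def span_singleton)
  then obtain k where k: "\<And>i. row i \<xi> = k i *\<^sub>R w" by metis
  define b where "b = (\<chi> i. k i)"
  have \<xi>: "\<xi> = outer b w"
    using k by (simp add: vec_eq_iff outer_def b_def row_def)
  have b: "b \<noteq> 0" using \<xi> assms(2) by (auto simp: outer_def vec_eq_iff)
  have "norm \<xi> *\<^sub>R outer (b /\<^sub>R norm b) (w /\<^sub>R norm w) = outer b w"
    unfolding \<xi> norm_outer using b w by (simp add: outer_def vec_eq_iff field_simps)
  then show ?thesis using \<xi> b w by (intro that[of "b /\<^sub>R norm b" "w /\<^sub>R norm w"]) auto
qed

text \<open>Beyond \<open>l / 2\<close> the radial profile is its supporting line plus a remainder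
  that never exceeds \<open>l^2 / 4\<close>, however large \<open>t\<close> is. This boundedness is
  what makes rare large gradients affordable.\<close>

lemma min_square_linear_shift:
  fixes t l :: real
  assumes "l > 0" "t \<ge> 0"
  shows "min ((l / 2 + t)\<^sup>2) (l * (l / 2 + t)) = l\<^sup>2 / 4 + l * t + min (t\<^sup>2) (l\<^sup>2 / 4)"
  by (simp add: min_def power2_eq_square field_simps)

text \<open>Lipschitz bound for the radial profile: the square has slope at most
  \<open>2 * l\<close> up to radius \<open>l\<close>, and the line has slope
  \<open>l\<close>.\<close>

lemma min_square_linear_perturb:
  fixes t d l :: real
  assumes l: "l > 0" and t: "t \<ge> 0" and d: "d \<ge> 0"
  shows "min ((t + d)\<^sup>2) (l * (t + d)) \<le> min (t\<^sup>2) (l * t) + 2 * l * d"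
proof (cases "t \<le> l")
  case t_le: True
  then have "t * t \<le> l * t" using t by (intro mult_right_mono) auto
  then have m: "min (t\<^sup>2) (l * t) = t\<^sup>2" by (simp add: power2_eq_square)
  show ?thesis
  proof (cases "t + d \<le> l")
    case True
    have "d * (2 * t + d) \<le> d * (2 * l)" using True t d by (intro mult_left_mono) auto
    then have "(t + d)\<^sup>2 \<le> t\<^sup>2 + 2 * l * d" by (simp add: power2_eq_square algebra_simps)
    then show ?thesis unfolding m by linarith
  next
    case False
    have "t * (l - t) \<le> l * d" using False t_le t by (intro mult_mono) auto
    then have "l * (t + d) \<le> t\<^sup>2 + 2 * l * d" by (simp add: power2_eq_square algebra_simps)
    then show ?thesis unfolding m by linarith
  qed
next
  case False
  then have "l * t \<le> t * t" using t by (intro mult_right_mono) auto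
  then have "min (t\<^sup>2) (l * t) = l * t" by (simp add: power2_eq_square)
  moreover have "l * (t + d) \<le> l * t + 2 * l * d" using l d by (simp add: algebra_simps)
  ultimately show ?thesis by linarith
qed

lemma h_simp_mono_norm:
  assumes "l > 0" "norm \<xi> \<le> t"
  shows "h_simp l \<xi> \<le> min (t\<^sup>2) (l * t)"
proof -
  have "(norm \<xi>)\<^sup>2 \<le> t\<^sup>2" "l * norm \<xi> \<le> l * t"
    using assms by (auto intro: power_mono mult_left_mono)
  then show ?thesis unfolding h_simp_def by linarith
qed

definition cutoff_grad :: "nat \<Rightarrow> real^'n \<Rightarrow> real^'n" where
  "cutoff_grad N x = (\<chi> j. frechet_derivative (cutoff N) (at x) (axis j 1))"

lemma cutoff_has_derivative: "(cutoff N has_derivative (\<lambda>h. cutoff_grad N x \<bullet> h)) (at x)"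
proof -
  have d: "(cutoff N has_derivative frechet_derivative (cutoff N) (at x)) (at x)"
    by (rule C_order_SucD(1)[OF C_order_cutoff[of "Suc 0"]])
  then interpret bounded_linear "frechet_derivative (cutoff N) (at x)" by (rule has_derivative_bounded_linear)
  have "frechet_derivative (cutoff N) (at x) h = cutoff_grad N x \<bullet> h" for h
  proof -
    have "h = (\<Sum>j\<in>UNIV. h $ j *\<^sub>R axis j 1)"
      using basis_expansion[of h] by (simp add: scalar_mult_eq_scaleR)
    then have "frechet_derivative (cutoff N) (at x) h = frechet_derivative (cutoff N) (at x) (\<Sum>j\<in>UNIV. h $ j *\<^sub>R axis j 1)"
      by (rule arg_cong)
    also have "\<dots> = cutoff_grad N x \<bullet> h" by (simp add: sum scaleR cutoff_grad_def inner_vec_def mult.commute)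
    finally show ?thesis .
  qed
  then have "frechet_derivative (cutoff N) (at x) = (\<lambda>h. cutoff_grad N x \<bullet> h)" by (rule ext)
  then show ?thesis using d by simp
qed

lemma cutoff_grad_bound: "\<exists>B. \<forall>x\<in>unit_cube. norm (cutoff_grad N x) \<le> B"
proof -
  have "continuous_on UNIV (\<lambda>x. frechet_derivative (cutoff N) (at x) (axis j 1))" for j :: 'a
    using C_order_SucD(2)[OF C_order_cutoff[of "Suc 0"]] by simp
  then have "continuous_on UNIV (cutoff_grad N :: real^'a \<Rightarrow> _)"
    unfolding cutoff_grad_def[abs_def] by (intro continuous_on_vec_lambda)
  then have "compact (cutoff_grad N ` cbox 0 (1 :: real^'a))"
    by (intro compact_continuous_image) (auto intro: continuous_on_subset)
  then obtain B where "\<forall>y\<in>cutoff_grad N ` cbox 0 (1 :: real^'a). norm y \<le> B"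
    using compact_imp_bounded bounded_iff by metis
  then show ?thesis
    by (intro exI[of _ B]) (auto simp: unit_cube_def mem_box_cart less_imp_le)
qed

text \<open>Amplitude \<open>1 / \<kappa>\<close> against frequency \<kappa>: the derivative of the
  oscillation does not shrink as \<kappa> grows, while the term with the gradient of the cutoff is
  of order \<open>1 / \<kappa>\<close>.\<close>

definition laminate :: "nat \<Rightarrow> real \<Rightarrow> real \<Rightarrow> real \<Rightarrow> real^'m \<Rightarrow> real^'n \<Rightarrow> real^'n \<Rightarrow> real^'m" where
  "laminate N \<kappa> r c a e x = (cutoff N x * (c / \<kappa> * poisson_primitive r (\<kappa> * (e \<bullet> x)))) *\<^sub>R a"

context
  fixes N :: nat and \<kappa> r c :: real and a :: "real^'m" and e :: "real^'n"
  assumes N: "N \<ge> 1" and \<kappa>: "\<kappa> > 0" and r: "0 < r" "r < 1"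
begin

lemma laminate_test_function: "laminate N \<kappa> r c a e \<in> test_functions unit_cube"
proof -
  let ?B = "cbox (\<chi> j. 1 / N) (\<chi> j. 1 - 1 / N) :: (real^'n) set"
  have "C_order k (laminate N \<kappa> r c a e)" for k
    unfolding laminate_def[abs_def]
    by (intro C_order_scaleR_left C_order_mult C_order_cutoff C_order_const C_order_poisson_primitive r C_order_inner)
  then have "smooth (laminate N \<kappa> r c a e)" by (simp add: smooth_def)
  moreover have "{x. laminate N \<kappa> r c a e x \<noteq> 0} \<subseteq> ?B"
  proof
    fix x assume "x \<in> {x. laminate N \<kappa> r c a e x \<noteq> 0}"
    then have "cutoff N x \<noteq> 0" by (auto simp: laminate_def)
    from cutoff_support[OF this] show "x \<in> ?B" by (simp add: mem_box_cart)
  qed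
  then have "closure {x. laminate N \<kappa> r c a e x \<noteq> 0} \<subseteq> ?B"
    by (rule closure_minimal) (rule closed_cbox)
  moreover from this have "compact (closure {x. laminate N \<kappa> r c a e x \<noteq> 0})"
    using compact_cbox compact_closure bounded_subset[OF bounded_cbox] closure_subset by (meson subset_trans)
  moreover have "?B \<subseteq> unit_cube"
  proof
    fix x assume x: "x \<in> ?B"
    have "0 < 1 / real N" using N by simp
    moreover have "1 / real N \<le> x $ j \<and> x $ j \<le> 1 - 1 / real N" for j
      using x by (simp add: mem_box_cart)
    ultimately show "x \<in> unit_cube" unfolding unit_cube_def by (smt (verit) mem_Collect_eq)
  qed
  ultimately show ?thesis by (auto simp: test_functions_def)
qed

lemma laminate_jacobian:
  "jacobian (laminate N \<kappa> r c a e) (at x) =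
     outer a ((cutoff N x * (c * (poisson r (\<kappa> * (e \<bullet> x)) - 1))) *\<^sub>R e
              + (c / \<kappa> * poisson_primitive r (\<kappa> * (e \<bullet> x))) *\<^sub>R cutoff_grad N x)" (is "_ = outer a ?g")
proof -
  have P: "((\<lambda>x. poisson_primitive r (\<kappa> * (e \<bullet> x))) has_derivative
      (\<lambda>h. (poisson r (\<kappa> * (e \<bullet> x)) - 1) * (\<kappa> * (e \<bullet> h)))) (at x)"
    by (rule has_derivative_compose[OF _ poisson_primitive_has_derivative[OF r, unfolded has_field_derivative_def]])
       (auto intro!: derivative_eq_intros)
  have "(laminate N \<kappa> r c a e has_derivative (\<lambda>h. (?g \<bullet> h) *\<^sub>R a)) (at x)"
    unfolding laminate_def[abs_def]
    by (rule derivative_eq_intros cutoff_has_derivative P refl)+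
       (use \<kappa> in \<open>auto simp: inner_add_left algebra_simps\<close>)
  then have "frechet_derivative (laminate N \<kappa> r c a e) (at x) = (\<lambda>h. (?g \<bullet> h) *\<^sub>R a)"
    using frechet_derivative_at by metis
  then show ?thesis
    by (simp add: jacobian_def matrix_def outer_def vec_eq_iff inner_axis mult.commute)
qed

text \<open>Apart from the gradient of the cutoff, the perturbed matrix is \<open>l / 2 + T\<close>
  times the unit matrix, and \<open>T \<ge> 0\<close> because the Poisson kernel is nonnegative; so
  \<open>min_square_linear_shift\<close> applies. Of the three error units, two come from the
  Lipschitz bound and one from replacing the exact slope by its component in
  \<open>J\<close>.\<close>

lemma laminate_pointwise:
  assumes l: "l > 0" and c: "c > 0" and a: "norm a = 1" and e: "norm e = 1"
    and B: "norm (cutoff_grad N x) \<le> B"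
  defines "J \<equiv> jacobian (laminate N \<kappa> r c a e) (at x)"
    and "T \<equiv> cutoff N x * (c * poisson r (\<kappa> * (e \<bullet> x))) + c * (1 - cutoff N x)"
  shows "h_simp l ((l / 2 + c) *\<^sub>R outer a e + J)
    \<le> l\<^sup>2 / 4 + l * c + (l *\<^sub>R outer a e) \<bullet> J + min (T\<^sup>2) (l\<^sup>2 / 4) + 3 * l * (c * pi * B) / \<kappa>"
proof -
  define p where "p = c / \<kappa> * poisson_primitive r (\<kappa> * (e \<bullet> x))"
  define g where "g = cutoff_grad N x"
  define q where "q = cutoff N x * (c * (poisson r (\<kappa> * (e \<bullet> x)) - 1))"
  have J: "J = outer a (q *\<^sub>R e + p *\<^sub>R g)"
    unfolding J_def laminate_jacobian p_def g_def q_def ..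
  have T0: "0 \<le> T"
    unfolding T_def using cutoff_bounds[of N x] poisson_nonneg[OF r] c by (intro add_nonneg_nonneg mult_nonneg_nonneg) auto
  have Tq: "l / 2 + c + q = l / 2 + T" by (simp add: T_def q_def algebra_simps)
  have pg: "norm (p *\<^sub>R g) \<le> c * pi * B / \<kappa>"
  proof -
    have "norm (p *\<^sub>R g) = c / \<kappa> * (\<bar>poisson_primitive r (\<kappa> * (e \<bullet> x))\<bar> * norm g)"
      using c \<kappa> by (simp add: p_def abs_mult)
    also have "\<dots> \<le> c / \<kappa> * (pi * B)"
      using B c \<kappa> poisson_primitive_bound[OF r] by (intro mult_left_mono mult_mono) (auto simp: g_def)
    finally show ?thesis by (simp add: mult_ac)
  qed
  define d where "d = c * pi * B / \<kappa>"
  have d: "norm (p *\<^sub>R g) \<le> d" "0 \<le> d" using pg norm_ge_zero[of "p *\<^sub>R g"] by (auto simp: d_def simp del: norm_ge_zero)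
  have "(l / 2 + c) *\<^sub>R outer a e + J = outer a ((l / 2 + T) *\<^sub>R e + p *\<^sub>R g)"
    unfolding J Tq[symmetric] by (simp add: outer_add outer_scaleR scaleR_add_left algebra_simps)
  then have "norm ((l / 2 + c) *\<^sub>R outer a e + J) = norm ((l / 2 + T) *\<^sub>R e + p *\<^sub>R g)"
    by (simp add: norm_outer a)
  also have "\<dots> \<le> norm ((l / 2 + T) *\<^sub>R e) + norm (p *\<^sub>R g)" by (rule norm_triangle_ineq)
  also have "\<dots> \<le> (l / 2 + T) + d" using e l T0 d by simp
  finally have "h_simp l ((l / 2 + c) *\<^sub>R outer a e + J) \<le> min (((l / 2 + T) + d)\<^sup>2) (l * ((l / 2 + T) + d))"
    by (rule h_simp_mono_norm[OF l])
  also have "\<dots> \<le> min ((l / 2 + T)\<^sup>2) (l * (l / 2 + T)) + 2 * l * d"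
    by (rule min_square_linear_perturb) (use l T0 d in auto)
  also have "min ((l / 2 + T)\<^sup>2) (l * (l / 2 + T)) = l\<^sup>2 / 4 + l * T + min (T\<^sup>2) (l\<^sup>2 / 4)"
    by (rule min_square_linear_shift[OF l T0])
  also have "l * T = l * c + l * q" using Tq by (simp flip: distrib_left)
  also have "l * q \<le> (l *\<^sub>R outer a e) \<bullet> J + l * d"
  proof -
    have "outer a e \<bullet> J = q + e \<bullet> (p *\<^sub>R g)"
      unfolding J outer_inner_outer a using e by (simp add: inner_add_right norm_eq_1)
    moreover have "- d \<le> e \<bullet> (p *\<^sub>R g)"
      using Cauchy_Schwarz_ineq2[of e "p *\<^sub>R g"] d e by simp
    ultimately have "q \<le> outer a e \<bullet> J + d" by linarith
    then have "l * q \<le> l * (outer a e \<bullet> J + d)" using l by (intro mult_left_mono) auto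
    then show ?thesis by (simp add: algebra_simps)
  qed
  finally show ?thesis by (simp add: d_def algebra_simps)
qed

end

lemma AE_cos_neq_1:
  fixes e :: "real^'n"
  assumes e: "e \<noteq> 0" and \<kappa>: "\<kappa> > 0"
  shows "AE x in lborel. cos (\<kappa> * (e \<bullet> x)) \<noteq> 1"
proof -
  let ?H = "\<lambda>k::int. {x. e \<bullet> x = of_int k * 2 * pi / \<kappa>}"
  have "?H k \<in> null_sets lborel" for k
  proof -
    have "negligible (?H k)" by (rule negligible_hyperplane) (use e in simp)
    then have "?H k \<in> null_sets lebesgue" by (simp add: negligible_iff_null_sets)
    moreover have "?H k \<in> sets lborel" using closed_hyperplane by (auto intro: borel_closed)
    ultimately show ?thesis by (simp add: null_sets_completion_iff)
  qed
  then have "(\<Union>k. ?H k) \<in> null_sets lborel" by (intro null_sets_UN) auto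
  moreover have "{x \<in> space lborel. \<not> cos (\<kappa> * (e \<bullet> x)) \<noteq> 1} \<subseteq> (\<Union>k. ?H k)"
    using \<kappa> by (auto simp: cos_one_2pi_int field_simps)
  ultimately show ?thesis by (rule AE_I')
qed

lemma set_integral_unit_cube_tendsto:
  fixes f :: "nat \<Rightarrow> real^'n \<Rightarrow> real"
  assumes f: "\<And>n. continuous_on UNIV (f n)" and g: "continuous_on UNIV g"
    and b: "\<And>n x. \<bar>f n x\<bar> \<le> b"
    and lim: "AE x in lborel. x \<in> unit_cube \<longrightarrow> (\<lambda>n. f n x) \<longlonglongrightarrow> g x"
  shows "(\<lambda>n. LINT x:unit_cube|lborel. f n x) \<longlonglongrightarrow> (LINT x:unit_cube|lborel. g x)"
  unfolding set_lebesgue_integral_def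
proof (rule integral_dominated_convergence[where w = "\<lambda>x. indicator unit_cube x *\<^sub>R b"])
  show "integrable lborel (\<lambda>x::real^'n. indicator unit_cube x *\<^sub>R b)"
    using set_integrable_unit_cube[of "\<lambda>_. b"] by (simp add: set_integrable_def)
  show "(\<lambda>x. indicator unit_cube x *\<^sub>R g x) \<in> borel_measurable lborel"
    using set_integrable_unit_cube[OF g] unfolding set_integrable_def by (rule borel_measurable_integrable)
  show "(\<lambda>x. indicator unit_cube x *\<^sub>R f n x) \<in> borel_measurable lborel" for n
    using set_integrable_unit_cube[OF f] unfolding set_integrable_def by (rule borel_measurable_integrable)
  show "AE x in lborel. (\<lambda>n. indicator unit_cube x *\<^sub>R f n x) \<longlonglongrightarrow> indicator unit_cube x *\<^sub>R g x"
    using lim by eventually_elim (auto simp: indicator_def)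
  show "AE x in lborel. norm (indicator unit_cube x *\<^sub>R f n x) \<le> indicator unit_cube x *\<^sub>R b" for n
    using b by (intro AE_I2) (auto simp: indicator_def)
qed

lemma continuous_on_cutoff: "continuous_on UNIV (cutoff N)"
  using C_order_cutoff[of 0] by simp

text \<open>The parameters are fixed in the order \<open>N\<close>, \<kappa>, \<open>r\<close>, each
  costing a third of \<epsilon>: \<open>N\<close> makes the boundary layer cheap, \<kappa> beats the
  gradient of that cutoff, and \<open>r\<close> is then sent to 1. Both limits are dominated by the
  bound \<open>l^2 / 4\<close> on \<open>m\<close>.\<close>

lemma quasiconvex_envelope_outer_le:
  fixes a :: "real^'m" and e :: "real^'n"
  assumes l: "l > 0" and c: "c > 0" and a: "norm a = 1" and e: "norm e = 1"
  shows "quasiconvex_envelope (h_simp l) ((l / 2 + c) *\<^sub>R outer a e) \<le> l\<^sup>2 / 4 + l * c"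
proof (rule field_le_epsilon)
  fix \<epsilon> :: real assume \<epsilon>: "\<epsilon> > 0"
  define m where "m t = min (t\<^sup>2) (l\<^sup>2 / 4)" for t :: real
  have m: "continuous_on UNIV m" "\<bar>m t\<bar> \<le> l\<^sup>2 / 4" "m 0 = 0" for t
    by (auto simp: m_def[abs_def] intro!: continuous_intros)
  have mc: "continuous_on UNIV (\<lambda>x. m (f x))" if "continuous_on UNIV f" for f :: "real^'n \<Rightarrow> real"
    using continuous_on_compose2[OF m(1) that] by simp
  have mt: "(\<lambda>n. m (f n)) \<longlonglongrightarrow> m t" if "f \<longlonglongrightarrow> t" for f :: "nat \<Rightarrow> real" and t
    using continuous_on_tendsto_compose[OF m(1) that] by simp
  have "(\<lambda>N. LINT x:(unit_cube::(real^'n) set)|lborel. m (c * (1 - cutoff N x))) \<longlonglongrightarrow> (LINT x:(unit_cube::(real^'n) set)|lborel. 0)"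
  proof (rule set_integral_unit_cube_tendsto[where b = "l\<^sup>2 / 4"])
    show "AE x::real^'n in lborel. x \<in> unit_cube \<longrightarrow> (\<lambda>N. m (c * (1 - cutoff N x))) \<longlonglongrightarrow> 0"
    proof (intro AE_I2 impI)
      fix x :: "real^'n" assume x: "x \<in> unit_cube"
      have "(\<lambda>N. c * (1 - cutoff N x)) \<longlonglongrightarrow> c * (1 - 1)" by (intro tendsto_intros cutoff_tendsto x)
      from mt[OF this] show "(\<lambda>N. m (c * (1 - cutoff N x))) \<longlonglongrightarrow> 0" using m(3) by simp
    qed
    show "\<bar>m (c * (1 - cutoff N x))\<bar> \<le> l\<^sup>2 / 4" for N and x :: "real^'n" by (rule m(2))
  qed (intro mc continuous_intros continuous_on_cutoff)+
  then have "eventually (\<lambda>N. (LINT x:(unit_cube::(real^'n) set)|lborel. m (c * (1 - cutoff N x))) < \<epsilon> / 3) sequentially"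
    by (rule order_tendstoD(2)) (use \<epsilon> in simp)
  then have "eventually (\<lambda>N. N \<ge> 1 \<and> (LINT x:(unit_cube::(real^'n) set)|lborel. m (c * (1 - cutoff N x))) < \<epsilon> / 3) sequentially"
    using eventually_ge_at_top[of 1] by eventually_elim simp
  then obtain N where N: "N \<ge> 1" "(LINT x:(unit_cube::(real^'n) set)|lborel. m (c * (1 - cutoff N x))) < \<epsilon> / 3"
    by (auto simp: eventually_sequentially)
  obtain B0 where B0: "\<And>x::real^'n. x \<in> unit_cube \<Longrightarrow> norm (cutoff_grad N x) \<le> B0"
    using cutoff_grad_bound by blast
  define B where "B = max B0 1"
  have B: "B > 0" "\<And>x::real^'n. x \<in> unit_cube \<Longrightarrow> norm (cutoff_grad N x) \<le> B"
    using B0 by (auto simp: B_def intro: max.coboundedI1)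
  define \<kappa> where "\<kappa> = 9 * l * (c * pi * B) / \<epsilon>"
  have \<kappa>: "\<kappa> > 0" using l c B \<epsilon> by (simp add: \<kappa>_def)
  have err: "3 * l * (c * pi * B) / \<kappa> = \<epsilon> / 3"
    using l c B \<epsilon> by (simp add: \<kappa>_def)
  define T where "T r x = cutoff N x * (c * poisson r (\<kappa> * (e \<bullet> x))) + c * (1 - cutoff N x)" for r x
  \<comment> \<open>The shift by 2 keeps \<open>R 0\<close> positive.\<close>
  define R where "R n = 1 - 1 / real (n + 2)" for n
  have R: "0 < R n" "R n < 1" for n by (auto simp: R_def field_simps)
  have R1: "R \<longlonglongrightarrow> 1" 
    using tendsto_diff[OF tendsto_const[of 1] LIMSEQ_ignore_initial_segment[OF lim_1_over_n, of 2]]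
    by (simp add: R_def[abs_def])
  have cT: "continuous_on UNIV (T r)" if r: "0 < r" "r < 1" for r
  proof -
    have "1 - 2 * r * cos z + r\<^sup>2 \<noteq> 0" for z using poisson_denominator[OF r, of z] by simp
    then show ?thesis unfolding T_def[abs_def] poisson_def by (intro continuous_intros continuous_on_cutoff) auto
  qed
  have "(\<lambda>n. LINT x:unit_cube|lborel. m (T (R n) x)) \<longlonglongrightarrow> (LINT x:(unit_cube::(real^'n) set)|lborel. m (c * (1 - cutoff N x)))"
  proof (rule set_integral_unit_cube_tendsto[where b = "l\<^sup>2 / 4"])
    have "e \<noteq> 0" using e by auto
    \<comment> \<open>Off countably many parallel hyperplanes the kernel tends to 0, so only the
      boundary-layer part of \<open>T\<close> is left in the limit.\<close>
    from AE_cos_neq_1[OF this \<kappa>]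
    show "AE x in lborel. x \<in> unit_cube \<longrightarrow> (\<lambda>n. m (T (R n) x)) \<longlonglongrightarrow> m (c * (1 - cutoff N x))"
    proof eventually_elim
      case (elim x)
      have "(\<lambda>n. T (R n) x) \<longlonglongrightarrow> cutoff N x * (c * 0) + c * (1 - cutoff N x)"
        unfolding T_def by (intro tendsto_intros poisson_tendsto_0 R1 elim)
      then show ?case using mt by simp
    qed
    show "\<bar>m (T (R n) x)\<bar> \<le> l\<^sup>2 / 4" for n x by (rule m(2))
  qed (intro mc cT R continuous_intros continuous_on_cutoff)+
  then have "eventually (\<lambda>n. (LINT x:unit_cube|lborel. m (T (R n) x)) < \<epsilon> / 3) sequentially"
    by (rule order_tendstoD(2)) (rule N(2))
  then obtain n where n: "(LINT x:unit_cube|lborel. m (T (R n) x)) < \<epsilon> / 3"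
    by (auto simp: eventually_sequentially)
  let ?\<phi> = "laminate N \<kappa> (R n) c a e" and ?\<xi> = "(l / 2 + c) *\<^sub>R outer a e"
  note tf = laminate_test_function[OF N(1) \<kappa> R, of n c a e]
  have pt: "h_simp l (?\<xi> + jacobian ?\<phi> (at x)) - (l\<^sup>2 / 4 + l * c) - (l *\<^sub>R outer a e) \<bullet> jacobian ?\<phi> (at x)
      \<le> m (T (R n) x) + \<epsilon> / 3" if "x \<in> unit_cube" for x
    using laminate_pointwise[OF N(1) \<kappa> R l c a e B(2)[OF that], of n] unfolding err m_def T_def by linarith
  have i1: "set_integrable lborel unit_cube (\<lambda>x. h_simp l (?\<xi> + jacobian ?\<phi> (at x)) - (l\<^sup>2 / 4 + l * c) - (l *\<^sub>R outer a e) \<bullet> jacobian ?\<phi> (at x))"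
    by (intro set_integrable_unit_cube continuous_intros continuous_on_compose2[OF continuous_on_h_simp[of UNIV]]
        test_function_jacobian_continuous[OF tf]) auto
  have i2: "set_integrable lborel unit_cube (\<lambda>x. m (T (R n) x))"
    by (intro set_integrable_unit_cube mc cT R)
  have i3: "set_integrable lborel unit_cube (\<lambda>x::real^'n. \<epsilon> / 3)"
    by (intro set_integrable_unit_cube continuous_intros)
  have "(LINT x:unit_cube|lborel. h_simp l (?\<xi> + jacobian ?\<phi> (at x))) - (l\<^sup>2 / 4 + l * c)
      \<le> (LINT x:unit_cube|lborel. m (T (R n) x) + \<epsilon> / 3)"
    unfolding energy_excess[OF tf, symmetric, where L = "l *\<^sub>R outer a e"]
    by (rule set_integral_mono[OF i1 set_integral_add(1)[OF i2 i3] pt])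
  also have "\<dots> = (LINT x:unit_cube|lborel. m (T (R n) x)) + \<epsilon> / 3"
    using set_integral_add(2)[OF i2 i3] by simp
  finally show "quasiconvex_envelope (h_simp l) ?\<xi> \<le> l\<^sup>2 / 4 + l * c + \<epsilon>"
    using n \<epsilon> quasiconvex_envelope_le[OF l tf, of ?\<xi>] by linarith
qed

lemma quasiconvex_envelope_rank_le_1:
  fixes \<xi> :: "real^'n^'m"
  assumes l: "l > 0" and \<xi>: "rank \<xi> \<le> 1" "norm \<xi> > l / 2"
  shows "quasiconvex_envelope (h_simp l) \<xi> \<le> huber l \<xi>"
proof -
  have "\<xi> \<noteq> 0" using l \<xi>(2) by auto
  obtain a :: "real^'m" and e :: "real^'n" where ae: "norm a = 1" "norm e = 1" "\<xi> = norm \<xi> *\<^sub>R outer a e"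
    by (rule rank_le_1_outer[OF \<xi>(1) \<open>\<xi> \<noteq> 0\<close>])
  have "quasiconvex_envelope (h_simp l) ((l / 2 + (norm \<xi> - l / 2)) *\<^sub>R outer a e) \<le> l\<^sup>2 / 4 + l * (norm \<xi> - l / 2)"
    by (rule quasiconvex_envelope_outer_le[OF l _ ae(1,2)]) (use \<xi> in simp)
  moreover have "(l / 2 + (norm \<xi> - l / 2)) *\<^sub>R outer a e = \<xi>" using ae(3) by simp
  moreover have "l\<^sup>2 / 4 + l * (norm \<xi> - l / 2) = huber l \<xi>"
    using \<xi>(2) by (simp add: huber_def power2_eq_square algebra_simps)
  ultimately show ?thesis by simp
qed

theorem lemma2p5:
  fixes l :: real and \<xi> :: "real^'n^'m"
  assumes "l > 0"
  shows "(norm \<xi> \<le> l / 2 \<longrightarrow>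
            h_simp l \<xi> = quasiconvex_envelope (h_simp l) \<xi> \<and>
            quasiconvex_envelope (h_simp l) \<xi> = convex_envelope (h_simp l) \<xi>) \<and>
         (rank \<xi> \<le> 1 \<longrightarrow>
            quasiconvex_envelope (h_simp l) \<xi> = convex_envelope (h_simp l) \<xi>) \<and>
         (rank \<xi> \<ge> 2 \<and> norm \<xi> > l / 2 \<longrightarrow>
            convex_envelope (h_simp l) \<xi> < quasiconvex_envelope (h_simp l) \<xi>)"
proof (intro conjI impI)
  have conv: "convex_envelope (h_simp l) \<xi> = huber l \<xi>" by (rule convex_envelope_h_simp[OF assms])
  have ge: "huber l \<xi> \<le> quasiconvex_envelope (h_simp l) \<xi>"
    by (rule quasiconvex_envelope_ge) (rule energy_ge_huber[OF assms])
  have small: "h_simp l \<xi> = quasiconvex_envelope (h_simp l) \<xi>" if "norm \<xi> \<le> l / 2"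
    using ge quasiconvex_envelope_le_h_simp[OF assms, of \<xi>] h_simp_eq_huber[OF assms that] by linarith
  then show "h_simp l \<xi> = quasiconvex_envelope (h_simp l) \<xi>" if "norm \<xi> \<le> l / 2" using that .
  show eq: "quasiconvex_envelope (h_simp l) \<xi> = convex_envelope (h_simp l) \<xi>" if "norm \<xi> \<le> l / 2"
    using small[OF that] h_simp_eq_huber[OF assms that] conv by linarith
  show "quasiconvex_envelope (h_simp l) \<xi> = convex_envelope (h_simp l) \<xi>" if "rank \<xi> \<le> 1"
  proof (cases "norm \<xi> \<le> l / 2")
    case False
    then show ?thesis
      using quasiconvex_envelope_rank_le_1[OF assms that] ge conv by linarith
  qed (rule eq)
  show "convex_envelope (h_simp l) \<xi> < quasiconvex_envelope (h_simp l) \<xi>"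
    if "rank \<xi> \<ge> 2 \<and> norm \<xi> > l / 2"
    using quasiconvex_envelope_gt_huber[OF assms, of \<xi>] that conv by simp
qed

end
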